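(* Let $\mathcal{A}$ be a factor von Neumann algebra acting on a Hilbert space $\mathcal{H}$ with $\dim(\mathcal{A})\ge 2$, and let $n\ge 2$ be an integer. Then every Lie $n$-derivation on $\mathcal{A}$ is standard.
   Context: Linear means $\mathbb{C}$-linear (no continuity is assumed); $\mathcal{Z}(\mathcal{A})$ is the centre of $\mathcal{A}$; a factor is a von Neumann algebra with $\mathcal{Z}(\mathcal{A})=\mathbb{C}I$. $[x,y]=xy-yx$. Define $p_1(x_1)=x_1$ and $p_n(x_1,\dots,x_n)=[p_{n-1}(x_1,\dots,x_{n-1}),x_n]$ for $n\ge2$; for $n\ge 2$, $p_n(x_1,\dots,x_n)$ is called an $(n-1)$-th commutator. A linear map $\varphi:\mathcal{A}\to\mathcal{A}$ is a Lie $n$-derivation if $\varphi(p_n(x_1,\dots,x_n))=\sum_{i=1}^n p_n(x_1,\dots,x_{i-1},\varphi(x_i),x_{i+1},\dots,x_n)$ for all $x_1,\dots,x_n\in\mathcal{A}$. A Lie $n$-derivation is standard if it equals $h+\tau$ with $h$ a derivation on $\mathcal{A}$ (linear, $h(xy)=h(x)y+xh(y)$) and $\tau$ a linear mapping from $\mathcal{A}$ into $\mathcal{Z}(\mathcal{A})$ vanishing on all $(n-1)$-th commutators of $\mathcal{A}$. *)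

theory Defs
  imports "HOL-Analysis.Analysis"
begin

class complex_vector = real_vector +
  fixes scaleC :: "complex \<Rightarrow> 'a \<Rightarrow> 'a" (infixr "*\<^sub>C" 75)
  assumes scaleC_add_right: "a *\<^sub>C (x + y) = a *\<^sub>C x + a *\<^sub>C y"
    and scaleC_add_left: "(a + b) *\<^sub>C x = a *\<^sub>C x + b *\<^sub>C x"
    and scaleC_scaleC: "a *\<^sub>C (b *\<^sub>C x) = (a * b) *\<^sub>C x"
    and scaleC_one: "1 *\<^sub>C x = x"
    and scaleR_scaleC: "r *\<^sub>R x = complex_of_real r *\<^sub>C x"

global_interpretation complex_vector: vector_space "scaleC :: complex \<Rightarrow> 'a \<Rightarrow> 'a::complex_vector"
  by unfold_locales (simp_all add: scaleC_add_right scaleC_add_left scaleC_scaleC scaleC_one)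

text \<open>
  Since the norm of a \<^class>\<open>banach\<close> space is definite, the last axiom makes the inner
  product positive definite, and the space is complete for the norm it induces.
\<close>
class complex_hilbert_space = complex_vector + banach +
  fixes cinner :: "'a \<Rightarrow> 'a \<Rightarrow> complex"
  assumes cinner_commute: "cinner x y = cnj (cinner y x)"
    and cinner_add_left: "cinner (x + y) z = cinner x z + cinner y z"
    and cinner_scaleC_left: "cinner (a *\<^sub>C x) y = a * cinner x y"
    and cinner_self: "cinner x x = complex_of_real ((norm x)\<^sup>2)"

text \<open>The bounded complex-linear operators on a Hilbert space, with composition as product.\<close>
typedef (overloaded) 'h bop =
  "{T :: 'h::complex_hilbert_space \<Rightarrow> 'h. bounded_linear T \<and> (\<forall>c x. T (c *\<^sub>C x) = c *\<^sub>C T x)}"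
  morphisms bop_apply Bop
  by (rule exI[of _ "\<lambda>x. 0"]) simp

setup_lifting type_definition_bop

lemma bounded_linear_scaleC: "bounded_linear (\<lambda>x::'h::complex_hilbert_space. c *\<^sub>C x)"
proof (rule bounded_linear_intro[where K = "cmod c"])
  show "norm (c *\<^sub>C x) \<le> norm x * cmod c" for x :: 'h
  proof -
    have "complex_of_real ((norm (c *\<^sub>C x))\<^sup>2) = cinner (c *\<^sub>C x) (c *\<^sub>C x)"
      by (simp add: cinner_self)
    also have "\<dots> = c * cnj c * cinner x x"
      by (metis cinner_commute cinner_scaleC_left complex_cnj_mult mult.assoc)
    also have "\<dots> = complex_of_real ((cmod c * norm x)\<^sup>2)"
      by (simp add: complex_norm_square[symmetric] cinner_self power_mult_distrib)
    finally have "(norm (c *\<^sub>C x))\<^sup>2 = (cmod c * norm x)\<^sup>2"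
      using of_real_eq_iff by blast
    then have "norm (c *\<^sub>C x) = cmod c * norm x"
      by (simp add: power2_eq_iff_nonneg)
    then show ?thesis
      by (simp add: mult.commute)
  qed
qed (simp_all add: scaleC_add_right scaleR_scaleC scaleC_scaleC mult.commute)

instantiation bop :: (complex_hilbert_space) "{complex_vector, ring, monoid_mult}"
begin

lift_definition zero_bop :: "'a bop" is "\<lambda>x. 0"
  by simp

lift_definition one_bop :: "'a bop" is "\<lambda>x. x"
  by simp

lift_definition plus_bop :: "'a bop \<Rightarrow> 'a bop \<Rightarrow> 'a bop" is "\<lambda>S T x. S x + T x"
  by (simp add: bounded_linear_add scaleC_add_right)

lift_definition uminus_bop :: "'a bop \<Rightarrow> 'a bop" is "\<lambda>T x. - T x"
  by (simp add: bounded_linear_minus)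

lift_definition minus_bop :: "'a bop \<Rightarrow> 'a bop \<Rightarrow> 'a bop" is "\<lambda>S T x. S x - T x"
  by (simp add: bounded_linear_sub complex_vector.scale_right_diff_distrib)

lift_definition times_bop :: "'a bop \<Rightarrow> 'a bop \<Rightarrow> 'a bop" is "\<lambda>S T x. S (T x)"
  by (auto intro: bounded_linear_compose)

lift_definition scaleC_bop :: "complex \<Rightarrow> 'a bop \<Rightarrow> 'a bop" is "\<lambda>c T x. c *\<^sub>C T x"
  by (auto intro: bounded_linear_compose[OF bounded_linear_scaleC] simp: scaleC_scaleC mult.commute)

lift_definition scaleR_bop :: "real \<Rightarrow> 'a bop \<Rightarrow> 'a bop" is "\<lambda>r T x. r *\<^sub>R T x"
  by (simp add: scaleR_scaleC scaleC_scaleC mult.commute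
      bounded_linear_compose[OF bounded_linear_scaleC])

instance
  by intro_classes
    (transfer; auto simp: fun_eq_iff algebra_simps scaleC_add_right scaleC_add_left
        scaleC_scaleC scaleC_one scaleR_scaleC dest: bounded_linear.linear linear_add)+

end

definition adj :: "'h::complex_hilbert_space bop \<Rightarrow> 'h bop" where
  "adj T = (THE S. \<forall>x y. cinner (bop_apply S x) y = cinner x (bop_apply T y))"

definition commutant :: "'h::complex_hilbert_space bop set \<Rightarrow> 'h bop set" where
  "commutant S = {T. \<forall>X\<in>S. T * X = X * T}"

text \<open>
  The double commutant condition already forces \<open>A\<close> to be a subalgebra containing the identity.
\<close>
definition von_neumann_algebra :: "'h::complex_hilbert_space bop set \<Rightarrow> bool" where
  "von_neumann_algebra A \<longleftrightarrow> (\<forall>T\<in>A. adj T \<in> A) \<and> commutant (commutant A) = A"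

definition center :: "'a::times set \<Rightarrow> 'a set" where
  "center A = {Z \<in> A. \<forall>X\<in>A. Z * X = X * Z}"

definition factor :: "'h::complex_hilbert_space bop set \<Rightarrow> bool" where
  "factor A \<longleftrightarrow> von_neumann_algebra A \<and> center A = range (\<lambda>c. c *\<^sub>C 1)"

text \<open>
  The complex dimension of \<open>A\<close> is at least \<open>k\<close>; the library's dimension function is \<open>0\<close>
  on infinite-dimensional spaces.
\<close>
definition cdim_ge :: "'a::complex_vector set \<Rightarrow> nat \<Rightarrow> bool" where
  "cdim_ge A k \<longleftrightarrow> (\<exists>B\<subseteq>A. finite B \<and> card B = k \<and> complex_vector.independent B)"

definition commutator :: "'a::ring \<Rightarrow> 'a \<Rightarrow> 'a" where
  "commutator x y = x * y - y * x"

text \<open>\<open>pcomm n x\<close> is $p_n(x_1,\dots,x_n)$; the value for \<open>n = 0\<close> is a dummy.\<close>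
fun pcomm :: "nat \<Rightarrow> (nat \<Rightarrow> 'a::ring) \<Rightarrow> 'a" where
  "pcomm 0 x = 0"
| "pcomm (Suc 0) x = x 1"
| "pcomm (Suc (Suc n)) x = commutator (pcomm (Suc n) x) (x (Suc (Suc n)))"

text \<open>
  Maps on \<open>A\<close> are represented by total functions, whose values outside \<open>A\<close> are irrelevant.
\<close>
definition clinear_on :: "'a::complex_vector set \<Rightarrow> 'b::complex_vector set \<Rightarrow> ('a \<Rightarrow> 'b) \<Rightarrow> bool" where
  "clinear_on A B f \<longleftrightarrow> f ` A \<subseteq> B \<and>
     (\<forall>x\<in>A. \<forall>y\<in>A. f (x + y) = f x + f y) \<and> (\<forall>c. \<forall>x\<in>A. f (c *\<^sub>C x) = c *\<^sub>C f x)"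

definition derivation_on :: "'a::{complex_vector,ring} set \<Rightarrow> ('a \<Rightarrow> 'a) \<Rightarrow> bool" where
  "derivation_on A h \<longleftrightarrow> clinear_on A A h \<and> (\<forall>x\<in>A. \<forall>y\<in>A. h (x * y) = h x * y + x * h y)"

definition lie_n_derivation :: "nat \<Rightarrow> 'a::{complex_vector,ring} set \<Rightarrow> ('a \<Rightarrow> 'a) \<Rightarrow> bool" where
  "lie_n_derivation n A \<phi> \<longleftrightarrow> clinear_on A A \<phi> \<and>
     (\<forall>x. (\<forall>i\<in>{1..n}. x i \<in> A) \<longrightarrow>
        \<phi> (pcomm n x) = (\<Sum>i=1..n. pcomm n (x(i := \<phi> (x i)))))"

definition standard :: "nat \<Rightarrow> 'a::{complex_vector,ring} set \<Rightarrow> ('a \<Rightarrow> 'a) \<Rightarrow> bool" where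
  "standard n A \<phi> \<longleftrightarrow> (\<exists>h \<tau>. derivation_on A h \<and> clinear_on A (center A) \<tau> \<and>
     (\<forall>x. (\<forall>i\<in>{1..n}. x i \<in> A) \<longrightarrow> \<tau> (pcomm n x) = 0) \<and>
     (\<forall>x\<in>A. \<phi> x = h x + \<tau> x))"

end

theory Submission
  imports Defs
begin

text \<open>
  A factor of dimension at least two contains a projection \<open>P\<close> other than \<open>0\<close> and \<open>1\<close>, and it is a
  prime algebra.  These two facts put the problem into pure algebra, where \<open>P\<close> and \<open>1 - P\<close> split
  the algebra into four Peirce corners \<open>p A p\<close>, \<open>p A q\<close>, \<open>q A p\<close>, \<open>q A q\<close>.

  Bracketing with \<open>p\<close> kills the diagonal corners and acts as \<open>-1\<close> and \<open>+1\<close> on the two off-diagonal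
  ones, so filling the last arguments of an iterated commutator with \<open>p\<close> loses no off-diagonal
  information.  After subtracting an inner derivation one may assume that \<open>\<phi> p\<close> is diagonal, and
  comparing \<open>\<phi>\<close> of the same power of the bracket in two ways forces \<open>\<phi> p\<close> to be central
  (\<open>phi_p_central\<close>).  The argument slots holding \<open>p\<close> then contribute nothing, and \<open>\<phi>\<close> is seen to
  preserve the two off-diagonal corners (\<open>phi_C_pq\<close>).  By faithfulness of the off-diagonal corners
  \<open>\<phi>\<close> is an ordinary Lie derivation up to central errors (\<open>phi_lie_central\<close>), so that from here on
  the value of \<open>n\<close> does not matter.

  An element of \<open>p A p\<close> commutes with \<open>q A q\<close>; hence the component of its image in \<open>q A q\<close> is central
  in that corner, and so it is \<open>z q\<close> for a central \<open>z\<close> (\<open>opposite_corner_central\<close>).  Collecting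
  these central elements gives the linear map \<open>central_part\<close>.  Subtracting it from \<open>\<phi>\<close> leaves a map
  that preserves all four corners and is a Lie derivation up to central errors, and every such map is a derivation
  (\<open>corner_lie_derivation\<close>).  Comparing the product rules of \<open>\<phi>\<close> and of this derivation
  shows that \<open>central_part\<close> kills \<open>(n-1)\<close>-th commutators.

  The analytic input is a supply of projections.  For a self-adjoint \<open>T\<close> which is not a multiple of
  the identity some real shift \<open>T - r\<close> is neither positive nor negative; with the absolute value
  \<open>S = |T - r|\<close> the operators \<open>T - r - S\<close> and \<open>T - r + S\<close> are non-zero and have product \<open>0\<close>
  (\<open>zero_divisors\<close>), and the projection onto the kernel of the first one is non-trivial.  The same
  zero divisors, taken inside a corner \<open>e A e\<close>, contradict primeness if \<open>e A e\<close> has a non-scalar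
  central element (\<open>corner_center\<close>).  Primeness itself holds because the projection onto the
  invariant subspace annihilated by all \<open>X a\<close> lies in the centre (\<open>prime\<close>).
\<close>

section \<open>Peirce corners of a prime algebra\<close>

lemma commutator_simps:
  fixes x y z :: "'a::ring"
  shows "commutator (x + y) z = commutator x z + commutator y z"
    "commutator x (y + z) = commutator x y + commutator x z"
    "commutator (x - y) z = commutator x z - commutator y z"
    "commutator x (y - z) = commutator x y - commutator x z"
    "commutator (- x) z = - commutator x z"
    "commutator x (- z) = - commutator x z"
    "commutator 0 z = 0" "commutator x 0 = 0"
  by (simp_all add: commutator_def algebra_simps)

lemma double_eq_0: "x + x = 0 \<longleftrightarrow> x = (0::'a::real_vector)"
proof
  assume "x + x = 0"
  then have "2 *\<^sub>R x = 0" by (simp add: scaleR_2)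
  then show "x = 0" by simp
qed simp

lemma pcomm_cong:
  assumes "\<And>i. 1 \<le> i \<Longrightarrow> i \<le> m \<Longrightarrow> x i = y i"
  shows "pcomm m x = pcomm m y"
  using assms by (induction m x rule: pcomm.induct) auto

text \<open>
  The algebra is a subset of the ambient ring, since a von Neumann algebra is a set of operators.
  The last two assumptions say that the centre of a diagonal corner comes from the centre of \<open>A\<close>.
  In a general prime algebra this can fail, because the centre of a corner may contain elements that
  come only from the extended centroid.  All assumptions are symmetric in \<open>p\<close> and \<open>q\<close>, so each fact about one corner yields the
  fact about the opposite one.
\<close>

locale peirce =
  fixes A :: "'a::{complex_vector,ring,monoid_mult} set" and p q :: 'a
  assumes add_in: "x \<in> A \<Longrightarrow> y \<in> A \<Longrightarrow> x + y \<in> A"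
    and mult_in: "x \<in> A \<Longrightarrow> y \<in> A \<Longrightarrow> x * y \<in> A"
    and scale_in: "x \<in> A \<Longrightarrow> c *\<^sub>C x \<in> A"
    and scale_mult_left: "x \<in> A \<Longrightarrow> y \<in> A \<Longrightarrow> (c *\<^sub>C x) * y = c *\<^sub>C (x * y)"
    and scale_mult_right: "x \<in> A \<Longrightarrow> y \<in> A \<Longrightarrow> x * (c *\<^sub>C y) = c *\<^sub>C (x * y)"
    and p_in: "p \<in> A" and q_in: "q \<in> A"
    and pp: "p * p = p" and qq: "q * q = q" and pq: "p * q = 0" and qp: "q * p = 0"
    and pq_sum: "p + q = 1" and p_nz: "p \<noteq> 0" and q_nz: "q \<noteq> 0"
    and prime: "x \<in> A \<Longrightarrow> y \<in> A \<Longrightarrow> (\<And>a. a \<in> A \<Longrightarrow> x * a * y = 0) \<Longrightarrow> x = 0 \<or> y = 0"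
    and center_p: "x \<in> A \<Longrightarrow> p * x = x \<Longrightarrow> x * p = x \<Longrightarrow>
      (\<And>a. a \<in> A \<Longrightarrow> p * a = a \<Longrightarrow> a * p = a \<Longrightarrow> x * a = a * x) \<Longrightarrow> \<exists>z\<in>center A. x = z * p"
    and center_q: "x \<in> A \<Longrightarrow> q * x = x \<Longrightarrow> x * q = x \<Longrightarrow>
      (\<And>a. a \<in> A \<Longrightarrow> q * a = a \<Longrightarrow> a * q = a \<Longrightarrow> x * a = a * x) \<Longrightarrow> \<exists>z\<in>center A. x = z * q"
begin

lemma peirce_swap: "peirce A q p"
  by (unfold_locales) (use add_in mult_in scale_in scale_mult_left scale_mult_right p_in q_in
     pp qq pq qp pq_sum p_nz q_nz prime center_p center_q in \<open>simp_all add: add.commute\<close>)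

lemma one_in: "1 \<in> A" using pq_sum p_in q_in add_in by metis

lemma uminus_in: "x \<in> A \<Longrightarrow> - x \<in> A"
  using scale_in[of x "-1"] by (simp add: scaleC_one)

lemma diff_in: "x \<in> A \<Longrightarrow> y \<in> A \<Longrightarrow> x - y \<in> A"
  using add_in[of x "- y"] uminus_in by simp

lemma zero_in: "0 \<in> A" using diff_in[OF one_in one_in] by simp

lemma commutator_in: "x \<in> A \<Longrightarrow> y \<in> A \<Longrightarrow> commutator x y \<in> A"
  by (simp add: commutator_def diff_in mult_in)

lemmas closed = add_in mult_in scale_in p_in q_in one_in uminus_in diff_in zero_in commutator_in

lemma q_eq: "q = 1 - p" using pq_sum by (simp add: algebra_simps)

lemma idem_simps [simp]:
  "p * p = p" "q * q = q" "p * q = 0" "q * p = 0"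
  "p * (p * x) = p * x" "q * (q * x) = q * x" "p * (q * x) = 0" "q * (p * x) = 0"
  by (simp_all add: pp qq pq qp mult.assoc[symmetric])

text \<open>
  The Peirce corner \<open>a A b\<close>, described as a set of fixed points so that membership can be used directly
  for rewriting.
\<close>

definition C :: "'a \<Rightarrow> 'a \<Rightarrow> 'a set" where
  "C a b = {x \<in> A. a * x = x \<and> x * b = x}"

lemma C_in: "x \<in> C a b \<Longrightarrow> x \<in> A" by (simp add: C_def)

lemma C_diff: "x \<in> C a b \<Longrightarrow> y \<in> C a b \<Longrightarrow> x - y \<in> C a b"
  by (simp_all add: C_def closed distrib_left distrib_right left_diff_distrib right_diff_distrib)

lemma C_mult: "x \<in> C a b \<Longrightarrow> y \<in> C b d \<Longrightarrow> x * y \<in> C a d"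
  by (simp add: C_def closed mult.assoc) (simp add: mult.assoc[symmetric])

lemma C_mult_0:
  assumes "x \<in> C a b" "y \<in> C d e" "b * d = 0" shows "x * y = 0"
proof -
  have "x * y = (x * b) * (d * y)" using assms by (simp add: C_def)
  also have "\<dots> = x * (b * d) * y" by (simp only: mult.assoc)
  finally show ?thesis using assms by simp
qed

lemma C_component: "x \<in> A \<Longrightarrow> a \<in> {p, q} \<Longrightarrow> b \<in> {p, q} \<Longrightarrow> a * x * b \<in> C a b"
  by (auto simp: C_def closed mult.assoc)

lemma peirce_decomp: "x = p * x * p + p * x * q + q * x * p + q * x * q"
  by (simp add: q_eq algebra_simps)

lemma C_simps:
  "x \<in> C p b \<Longrightarrow> p * x = x" "x \<in> C q b \<Longrightarrow> q * x = x"
  "x \<in> C a p \<Longrightarrow> x * p = x" "x \<in> C a q \<Longrightarrow> x * q = x"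
  by (simp_all add: C_def)

lemma C_annihil:
  "x \<in> C p b \<Longrightarrow> q * x = 0" "x \<in> C q b \<Longrightarrow> p * x = 0"
  "x \<in> C a p \<Longrightarrow> x * q = 0" "x \<in> C a q \<Longrightarrow> x * p = 0"
  by (simp_all add: C_def q_eq algebra_simps)

text \<open>
  Primeness makes the corner \<open>p A q\<close> faithful on both sides: if \<open>a\<close> kills \<open>p A q\<close>, then \<open>a A q = 0\<close>.
  Identities in the diagonal corners can therefore be tested on off-diagonal elements.
\<close>

lemma annihilate_right:
  assumes "a \<in> C d p" and "\<And>z. z \<in> C p q \<Longrightarrow> a * z = 0"
  shows "a = 0"
proof -
  have "a * x * q = 0" if "x \<in> A" for x
  proof -
    have "a * x * q = a * (p * x * q)"
      using assms(1) by (simp add: C_def mult.assoc[symmetric])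
    also have "\<dots> = 0" using assms(2) C_component[OF that] by simp
    finally show ?thesis .
  qed
  then show ?thesis using prime[of a q] assms(1) C_in closed q_nz by blast
qed

lemma annihilate_left:
  assumes "a \<in> C q d" and "\<And>z. z \<in> C p q \<Longrightarrow> z * a = 0"
  shows "a = 0"
proof -
  have "p * x * a = 0" if "x \<in> A" for x
  proof -
    have "p * x * a = (p * x * q) * a"
      using assms(1) by (simp add: C_def mult.assoc)
    also have "\<dots> = 0" using assms(2) C_component[OF that] by simp
    finally show ?thesis .
  qed
  then show ?thesis using prime[of p a] assms(1) C_in closed p_nz by blast
qed

lemma semiprime:
  assumes "v \<in> C q p" and "\<And>x. x \<in> C p q \<Longrightarrow> v * x * v = 0"
  shows "v = 0"
proof -
  have "v * x * v = 0" if "x \<in> A" for x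
  proof -
    have "v * x * v = v * (p * x * q) * v"
      using assms(1) by (simp add: C_def mult.assoc) (simp add: C_def mult.assoc[symmetric])
    also have "\<dots> = 0" using assms(2) C_component[OF that] by simp
    finally show ?thesis .
  qed
  then show ?thesis using prime[of v v] assms(1) C_in by blast
qed

lemma center_in: "z \<in> center A \<Longrightarrow> z \<in> A" by (simp add: center_def)

lemma center_commute: "z \<in> center A \<Longrightarrow> x \<in> A \<Longrightarrow> z * x = x * z" by (simp add: center_def)

lemma center_closed:
  "x \<in> center A \<Longrightarrow> y \<in> center A \<Longrightarrow> x + y \<in> center A"
  "x \<in> center A \<Longrightarrow> y \<in> center A \<Longrightarrow> x - y \<in> center A"
  "x \<in> center A \<Longrightarrow> - x \<in> center A"
  "0 \<in> center A"
  "x \<in> center A \<Longrightarrow> c *\<^sub>C x \<in> center A"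
  unfolding center_def
  by (simp_all add: closed scale_mult_left scale_mult_right distrib_left distrib_right
      left_diff_distrib right_diff_distrib)

lemma center_mult_eq_0:
  assumes "z \<in> center A" "x \<in> A" "z * x = 0" shows "z = 0 \<or> x = 0"
proof (rule prime)
  fix a assume "a \<in> A"
  have "z * a * x = a * (z * x)"
    using center_commute[OF assms(1) \<open>a \<in> A\<close>] by (simp add: mult.assoc)
  then show "z * a * x = 0" using assms by simp
qed (use assms center_in in auto)

lemma center_Int_C: "z \<in> center A \<Longrightarrow> z \<in> C p q \<Longrightarrow> z = 0"
  using C_simps(1)[of z q] C_annihil(4)[of z p] center_commute[of z p] p_in by simp

lemma commute_C:
  assumes "d \<in> A" "d * a = a * d" "d * b = b * d" "x \<in> C a b"
  shows "d * x \<in> C a b" "x * d \<in> C a b"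
proof -
  have x: "x \<in> A" "a * x = x" "x * b = x" using assms(4) by (simp_all add: C_def)
  have "a * (d * x) = d * (a * x)" by (simp only: mult.assoc[symmetric] assms(2))
  moreover have "x * d * b = (x * b) * d" by (simp only: mult.assoc assms(3))
  moreover have "d * x * b = d * (x * b)" "a * (x * d) = (a * x) * d" by (simp_all only: mult.assoc)
  ultimately show "d * x \<in> C a b" "x * d \<in> C a b"
    using x assms(1) by (simp_all add: C_def closed)
qed

text \<open>
  A diagonal element commuting with one off-diagonal corner is central.  For \<open>x\<close> in \<open>p A p\<close> both \<open>z\<close>
  and \<open>x z\<close> lie in \<open>p A q\<close>, so \<open>[d, x]\<close> kills \<open>p A q\<close> from the left; the corner \<open>q A q\<close> is treated
  from the other side, and \<open>q A p\<close> by multiplying it back into \<open>p A p\<close>.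
\<close>

lemma diag_central:
  assumes d: "d \<in> A" "d * p = p * d"
    and comm: "\<And>z. z \<in> C p q \<Longrightarrow> d * z = z * d"
  shows "d \<in> center A"
proof -
  have dq: "d * q = q * d" using d by (simp add: q_eq algebra_simps)
  have Cd: "d * x \<in> C a b" "x * d \<in> C a b" if "x \<in> C a b" "a \<in> {p,q}" "b \<in> {p,q}" for x a b
    using commute_C[OF d(1) _ _ that(1)] that(2,3) d(2) dq by auto
  have pp: "d * x = x * d" if x: "x \<in> C p p" for x
  proof -
    have "d * x - x * d = 0"
    proof (rule annihilate_right)
      show "d * x - x * d \<in> C p p" using Cd[OF x] C_diff by simp
      fix z assume z: "z \<in> C p q"
      have xz: "x * z \<in> C p q" using C_mult x z by blast
      have "d * (x * z) = x * (d * z)" using comm[OF xz] comm[OF z] by (simp add: mult.assoc)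
      then show "(d * x - x * d) * z = 0" by (simp add: algebra_simps)
    qed
    then show ?thesis by simp
  qed
  have qq: "d * x = x * d" if x: "x \<in> C q q" for x
  proof -
    have "d * x - x * d = 0"
    proof (rule annihilate_left)
      show "d * x - x * d \<in> C q q" using Cd[OF x] C_diff by simp
      fix z assume z: "z \<in> C p q"
      have zx: "z * x \<in> C p q" using C_mult x z by blast
      have "z * (d * x) = z * x * d"
        by (simp only: mult.assoc[symmetric] comm[OF z, symmetric]) (simp only: mult.assoc comm[OF zx])
      then show "z * (d * x - x * d) = 0" by (simp add: algebra_simps)
    qed
    then show ?thesis by simp
  qed
  have qp: "d * x = x * d" if x: "x \<in> C q p" for x
  proof -
    have "d * x - x * d = 0"
    proof (rule annihilate_left)
      show "d * x - x * d \<in> C q p" using Cd[OF x] C_diff by simp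
      fix z assume z: "z \<in> C p q"
      have zx: "z * x \<in> C p p" using C_mult x z by blast
      have "z * (d * x) = z * x * d"
        by (simp only: mult.assoc[symmetric] comm[OF z, symmetric]) (simp only: mult.assoc pp[OF zx])
      then show "z * (d * x - x * d) = 0" by (simp add: algebra_simps)
    qed
    then show ?thesis by simp
  qed
  have "d * x = x * d" if "x \<in> A" for x
  proof -
    have c: "d * (p * x * p) = p * x * p * d" "d * (p * x * q) = p * x * q * d"
      "d * (q * x * p) = q * x * p * d" "d * (q * x * q) = q * x * q * d"
      by (rule pp comm qp qq, rule C_component, use that in simp_all)+
    have "d * (p * x * p + p * x * q + q * x * p + q * x * q)
      = (p * x * p + p * x * q + q * x * p + q * x * q) * d"
      by (simp only: distrib_left distrib_right c)
    then show ?thesis by (simp only: peirce_decomp[symmetric])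
  qed
  then show ?thesis using d by (simp add: center_def)
qed

text \<open>
  The bracket with \<open>p\<close> vanishes on the diagonal corners and is \<open>-1\<close> on \<open>p A q\<close> and \<open>+1\<close> on \<open>q A p\<close>.
  Hence \<open>D \<circ> D\<close> is the projection onto the off-diagonal part, an element \<open>x\<close> is off-diagonal iff
  \<open>D (D x) = x\<close>, and it is diagonal iff \<open>D x = 0\<close>.
\<close>

definition D :: "'a \<Rightarrow> 'a" where "D x = commutator x p"

lemma D_in: "x \<in> A \<Longrightarrow> D x \<in> A" by (simp add: D_def closed)

lemma D_pow_in: "x \<in> A \<Longrightarrow> (D ^^ k) x \<in> A" by (induction k) (auto simp: D_in)

lemma D_add: "D (x + y) = D x + D y" and D_diff: "D (x - y) = D x - D y"
  and D_0: "D 0 = 0" and D_minus: "D (- x) = - D x"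
  by (simp_all add: D_def commutator_simps)

lemma D_pow_add: "(D ^^ k) (x + y) = (D ^^ k) x + (D ^^ k) y" by (induction k) (auto simp: D_add)
lemma D_pow_diff: "(D ^^ k) (x - y) = (D ^^ k) x - (D ^^ k) y" by (induction k) (auto simp: D_diff)
lemma D_pow_0: "(D ^^ k) 0 = 0" by (induction k) (auto simp: D_0)
lemma D_pow_sum: "(D ^^ k) (sum f S) = (\<Sum>i\<in>S. (D ^^ k) (f i))"
  by (induction S rule: infinite_finite_induct) (auto simp: D_pow_0 D_pow_add)

lemma DD: "D (D x) = p * x * q + q * x * p"
proof -
  have "D (D x) = x * (p * p) - p * x * p - (p * x * p - (p * p) * x)"
    by (simp only: D_def commutator_def algebra_simps)
  then show ?thesis by (simp add: pp q_eq algebra_simps)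
qed
 
lemma DDD: "D (D (D x)) = D x"
  unfolding DD by (simp add: D_def commutator_def q_eq algebra_simps)

lemma D_C: "x \<in> C p q \<Longrightarrow> D x = - x" "x \<in> C q p \<Longrightarrow> D x = x"
  by (simp_all add: D_def commutator_def C_simps C_annihil)

lemma D_0_iff: "D x = 0 \<longleftrightarrow> x * p = p * x" by (simp add: D_def commutator_def)

lemma D_pow_eq_0:
  assumes "(D ^^ Suc k) x = 0" shows "D x = 0"
  using assms
proof (induction k arbitrary: x)
  case (Suc k)
  have "(D ^^ Suc k) (D x) = 0" using Suc.prems by (simp add: funpow_swap1)
  then have "D (D x) = 0" by (rule Suc.IH)
  then show ?case using DDD[of x] by (simp add: D_0)
qed simp

lemma D_even: "D (D x) = x \<Longrightarrow> even k \<Longrightarrow> (D ^^ k) x = x"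
  by (induction k rule: induct_nat_012) auto

lemma D_pow_comm:
  assumes "d * p = p * d"
  shows "commutator ((D ^^ k) x) d = (D ^^ k) (commutator x d)"
proof (induction k)
  case (Suc k)
  have "commutator (D y) d = D (commutator y d)" for y
    unfolding D_def commutator_def using assms
    by (simp add: algebra_simps) (metis mult.assoc)
  then show ?case using Suc by simp
qed simp

lemma C_D_pow_eq_0: "x \<in> C p q \<Longrightarrow> (D ^^ k) x = 0 \<Longrightarrow> x = 0"
  by (cases k) (use D_pow_eq_0 D_C in fastforce)+

lemma diag_commutator_C:
  assumes "w \<in> A" "w * p = p * w" "z \<in> C p q"
  shows "commutator w z \<in> C p q"
proof -
  have "w * q = q * w" using assms by (simp add: q_eq algebra_simps)
  then have "w * z \<in> C p q" "z * w \<in> C p q"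
    using commute_C[of w p q z] assms by auto
  then show ?thesis unfolding commutator_def by (rule C_diff)
qed

lemma pcomm_tail:
  assumes "\<And>i. m < i \<Longrightarrow> i \<le> m + k \<Longrightarrow> x i = p" and "m \<ge> 1"
  shows "pcomm (m + k) x = (D ^^ k) (pcomm m x)"
  using assms
proof (induction k)
  case (Suc k)
  obtain j where "m + k = Suc j" using \<open>m \<ge> 1\<close> by (cases "m + k") auto
  then show ?case using Suc by (simp add: D_def)
qed simp

lemma pcomm_in:
  assumes "\<And>i. 1 \<le> i \<Longrightarrow> i \<le> m \<Longrightarrow> x i \<in> A" shows "pcomm m x \<in> A"
  using assms by (induction m x rule: pcomm.induct) (auto simp: closed)

lemma pcomm_central:
  assumes "\<And>i. 1 \<le> i \<Longrightarrow> i \<le> m \<Longrightarrow> x i \<in> A" and "1 \<le> j" "j \<le> m" "m \<ge> 2" "x j \<in> center A"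
  shows "pcomm m x = 0"
  using assms
proof (induction m x rule: pcomm.induct)
  case (3 m x)
  have inA: "pcomm (Suc m) x \<in> A" using 3(2) by (intro pcomm_in) auto
  show ?case
  proof (cases "j = Suc (Suc m)")
    case True
    then show ?thesis using center_commute[OF 3(6) inA] by (simp add: commutator_def)
  next
    case False
    show ?thesis
    proof (cases m)
      case 0
      then have "j = 1" using 3 False by simp
      then show ?thesis using 0 center_commute[OF 3(6), of "x 2"] 3(2)[of 2]
        by (simp add: commutator_def numeral_2_eq_2)
    next
      case (Suc m')
      then show ?thesis using 3 False by (simp add: commutator_simps)
    qed
  qed
qed auto

end

section \<open>Lie n-derivations and the Peirce decomposition\<close>

locale lie_n = peirce A p q for A :: "'a::{complex_vector,ring,monoid_mult} set" and p q +
  fixes n :: nat and \<phi> :: "'a \<Rightarrow> 'a"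
  assumes n_ge: "n \<ge> 2" and lie: "lie_n_derivation n A \<phi>"
begin

lemma phi_in: "x \<in> A \<Longrightarrow> \<phi> x \<in> A"
  and phi_add: "x \<in> A \<Longrightarrow> y \<in> A \<Longrightarrow> \<phi> (x + y) = \<phi> x + \<phi> y"
  and phi_scale: "x \<in> A \<Longrightarrow> \<phi> (c *\<^sub>C x) = c *\<^sub>C \<phi> x"
  using lie unfolding lie_n_derivation_def clinear_on_def by auto

lemma phi_0: "\<phi> 0 = 0"
  using phi_add[of 0 0] zero_in by simp

lemma phi_minus: "x \<in> A \<Longrightarrow> \<phi> (- x) = - \<phi> x"
  using phi_add[of x "- x"] uminus_in phi_0 by (simp add: add_eq_0_iff)

lemma phi_diff: "x \<in> A \<Longrightarrow> y \<in> A \<Longrightarrow> \<phi> (x - y) = \<phi> x - \<phi> y"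
  using phi_add[of x "- y"] uminus_in phi_minus by simp

lemma phi_pcomm:
  "(\<And>i. 1 \<le> i \<Longrightarrow> i \<le> n \<Longrightarrow> x i \<in> A) \<Longrightarrow>
    \<phi> (pcomm n x) = (\<Sum>i=1..n. pcomm n (x(i := \<phi> (x i))))"
  using lie unfolding lie_n_derivation_def by auto

lemma pcomm_phi_one:
  assumes "\<And>i. 1 \<le> i \<Longrightarrow> i \<le> n \<Longrightarrow> x i \<in> A" and "x 1 = 1"
  shows "pcomm n (x(1 := \<phi> 1)) = 0"
proof -
  have one: "1 \<in> center A" by (simp add: center_def closed)
  have "pcomm n x = 0"
    using assms one n_ge by (intro pcomm_central[of n x 1]) auto
  then have "0 = (\<Sum>i=1..n. pcomm n (x(i := \<phi> (x i))))"
    using phi_pcomm[of x] assms(1) by (simp add: phi_0)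
  also have "\<dots> = (\<Sum>i\<in>{1}. pcomm n (x(i := \<phi> (x i))))"
  proof (rule sum.mono_neutral_right)
    show "\<forall>i\<in>{1..n} - {1}. pcomm n (x(i := \<phi> (x i))) = 0"
    proof
      fix i assume "i \<in> {1..n} - {1}"
      then show "pcomm n (x(i := \<phi> (x i))) = 0"
        using assms one n_ge phi_in by (intro pcomm_central[of n _ 1]) auto
    qed
  qed (use n_ge in auto)
  finally show ?thesis using assms(2) by simp
qed

text \<open>
  A commutator with \<open>1\<close> as first argument vanishes, and so do all summands of its derivative except
  the one containing \<open>\<phi> 1\<close>.  Filling the other slots with \<open>p\<close>, or with one element of \<open>p A q\<close> and
  then \<open>p\<close>, shows that \<open>\<phi> 1\<close> is diagonal and commutes with \<open>p A q\<close>.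
\<close>

lemma phi_one_central: "\<phi> 1 \<in> center A"
proof (rule diag_central)
  show "\<phi> 1 \<in> A" by (simp add: phi_in closed)
  define u :: "nat \<Rightarrow> 'a" where "u = (\<lambda>i. if i = 1 then 1 else p)"
  have "pcomm (1 + (n - 1)) (u(1 := \<phi> 1)) = (D ^^ (n - 1)) (pcomm 1 (u(1 := \<phi> 1)))"
    by (rule pcomm_tail) (auto simp: u_def)
  moreover have "pcomm n (u(1 := \<phi> 1)) = 0"
    by (rule pcomm_phi_one) (auto simp: u_def closed)
  ultimately have "(D ^^ Suc (n - 2)) (\<phi> 1) = 0"
    using n_ge by (simp add: Suc_diff_Suc numeral_2_eq_2 del: funpow.simps)
  then have "D (\<phi> 1) = 0" by (rule D_pow_eq_0)
  then show d: "\<phi> 1 * p = p * \<phi> 1" by (simp add: D_0_iff)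
  fix z assume z: "z \<in> C p q"
  define v :: "nat \<Rightarrow> 'a" where "v = (\<lambda>i. if i = 1 then 1 else if i = 2 then z else p)"
  have "pcomm (2 + (n - 2)) (v(1 := \<phi> 1)) = (D ^^ (n - 2)) (pcomm 2 (v(1 := \<phi> 1)))"
    by (rule pcomm_tail) (auto simp: v_def)
  moreover have "pcomm 2 (v(1 := \<phi> 1)) = commutator (\<phi> 1) z"
    by (simp add: v_def numeral_2_eq_2)
  moreover have "pcomm n (v(1 := \<phi> 1)) = 0"
    by (rule pcomm_phi_one) (use z C_in in \<open>auto simp: v_def closed\<close>)
  ultimately have "(D ^^ (n - 2)) (commutator (\<phi> 1) z) = 0"
    by (simp only: le_add_diff_inverse[OF n_ge])
  then have "commutator (\<phi> 1) z = 0"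
    using C_D_pow_eq_0 diag_commutator_C z d phi_in one_in by blast
  then show "\<phi> 1 * z = z * \<phi> 1" by (simp add: commutator_def)
qed

text \<open>
  If \<open>\<phi> p\<close> commutes with \<open>p\<close>, then bracketing with \<open>\<phi> p\<close> commutes with \<open>D\<close>.  It is therefore
  immaterial which of the \<open>n - 1\<close> slots holding \<open>p\<close> is differentiated.
\<close>

lemma phi_D_pow:
  assumes d: "\<phi> p * p = p * \<phi> p" and x: "x \<in> A"
  shows "\<phi> ((D ^^ (n - 1)) x) =
    (D ^^ (n - 1)) (\<phi> x) + (\<Sum>i=2..n. (D ^^ (n - 2)) (commutator x (\<phi> p)))"
proof -
  define u where "u = (\<lambda>i::nat. if i = 1 then x else p)"
  have tail: "pcomm n w = (D ^^ (n - m)) (pcomm m w)"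
    if "\<And>i. m < i \<Longrightarrow> i \<le> n \<Longrightarrow> w i = p" "1 \<le> m" "m \<le> n" for m w
    using pcomm_tail[of m "n - m" w] that by simp
  have ins: "pcomm n (u(i := \<phi> p)) = (D ^^ (n - 2)) (commutator x (\<phi> p))"
    if i: "2 \<le> i" "i \<le> n" for i
  proof -
    define j where "j = i - 2"
    have ij: "i = Suc (Suc j)" using i by (simp add: j_def)
    have "pcomm n (u(i := \<phi> p)) = (D ^^ (n - i)) (pcomm i (u(i := \<phi> p)))"
      by (rule tail) (use i in \<open>auto simp: u_def\<close>)
    also have "pcomm i (u(i := \<phi> p)) = commutator (pcomm (1 + j) (u(i := \<phi> p))) (\<phi> p)"
      by (simp add: ij)
    also have "pcomm (1 + j) (u(i := \<phi> p)) = (D ^^ j) (pcomm 1 (u(i := \<phi> p)))"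
      by (rule pcomm_tail) (auto simp: u_def ij)
    also have "pcomm 1 (u(i := \<phi> p)) = x" by (simp add: u_def ij)
    also have "commutator ((D ^^ j) x) (\<phi> p) = (D ^^ j) (commutator x (\<phi> p))"
      by (rule D_pow_comm[OF d])
    also have "(D ^^ (n - i)) \<dots> = (D ^^ (n - i + j)) (commutator x (\<phi> p))"
      by (simp add: funpow_add)
    also have "n - i + j = n - 2" using i by (simp add: j_def)
    finally show ?thesis .
  qed
  have "\<phi> (pcomm n u) = (\<Sum>i=1..n. pcomm n (u(i := \<phi> (u i))))"
    by (rule phi_pcomm) (use x in \<open>auto simp: u_def closed\<close>)
  also have "\<dots> = pcomm n (u(1 := \<phi> x)) + (\<Sum>i=2..n. pcomm n (u(i := \<phi> (u i))))"
    using n_ge by (simp add: sum.atLeast_Suc_atMost u_def numeral_2_eq_2)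
  also have "(\<Sum>i=2..n. pcomm n (u(i := \<phi> (u i)))) =
      (\<Sum>i=2..n. (D ^^ (n - 2)) (commutator x (\<phi> p)))"
  proof (rule sum.cong)
    fix i assume "i \<in> {2..n}"
    then show "pcomm n (u(i := \<phi> (u i))) = (D ^^ (n - 2)) (commutator x (\<phi> p))"
      using ins[of i] by (simp add: u_def)
  qed simp
  also have "pcomm n (u(1 := \<phi> x)) = (D ^^ (n - 1)) (\<phi> x)"
    using tail[of 1 "u(1 := \<phi> x)"] n_ge by (simp add: u_def)
  also have "pcomm n u = (D ^^ (n - 1)) x"
    using tail[of 1 u] n_ge by (simp add: u_def)
  finally show ?thesis .
qed

text \<open>
  Apply the formula for \<open>\<phi> \<circ> D^(n-1)\<close> twice to an off-diagonal \<open>x\<close>.  As \<open>D^(2n-2)\<close> is the identity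
  on off-diagonal elements, this expresses the off-diagonal part of \<open>\<phi> x\<close> as itself plus \<open>2 (n - 1)\<close>
  copies of an element that differs from \<open>[x, \<phi> p]\<close> by a sign only.  Doubling the exponent makes
  the parity of \<open>n\<close> irrelevant.
\<close>

lemma phi_p_central:
  assumes d: "\<phi> p * p = p * \<phi> p"
  shows "\<phi> p \<in> center A"
proof (rule diag_central[OF phi_in[OF p_in] d])
  fix x assume xC: "x \<in> C p q"
  let ?M = "D ^^ (n - 1)" and ?d = "commutator x (\<phi> p)"
  have x: "x \<in> A" using xC by (rule C_in)
  have DDx: "D (D x) = x" using xC by (simp add: D_C D_minus)
  define v where "v = ?M ((D ^^ (n - 2)) ?d)"
  have MM: "?M (?M y) = (D ^^ (2 * (n - 1))) y" for y
    by (simp add: mult_2 funpow_add)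
  have DMM: "D (?M (?M y)) = D y" for y
  proof -
    have "D (?M (?M y)) = (D ^^ (2 * (n - 1))) (D y)" unfolding MM by (rule funpow_swap1)
    also have "\<dots> = D y" by (rule D_even) (auto simp: DDD)
    finally show ?thesis .
  qed
  have "x = ?M (?M x)" unfolding MM using D_even[OF DDx] by simp
  then have "\<phi> x = \<phi> (?M (?M x))" by simp
  also have "\<dots> = ?M (\<phi> (?M x)) + (\<Sum>i=2..n. (D ^^ (n - 2)) (commutator (?M x) (\<phi> p)))"
    by (rule phi_D_pow[OF d]) (simp add: D_pow_in x)
  also have "(D ^^ (n - 2)) (commutator (?M x) (\<phi> p)) = v"
    unfolding v_def D_pow_comm[OF d] by (metis add.commute comp_apply funpow_add)
  also have "?M (\<phi> (?M x)) = ?M (?M (\<phi> x)) + (\<Sum>i=2..n. v)"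
    by (simp only: phi_D_pow[OF d x] D_pow_add D_pow_sum v_def)
  \<comment> \<open>only \<open>D\<close> of both sides is compared, because \<open>?M (?M (\<phi> x))\<close> has lost the diagonal part of \<open>\<phi> x\<close>\<close>
  finally have "D (\<phi> x) = D (\<phi> x) + D ((\<Sum>i=2..n. v) + (\<Sum>i=2..n. v))"
    by (metis DMM D_add add.assoc)
  then have "D (\<Sum>i=2..n. v) = 0" by (simp add: D_add double_eq_0)
  then have "(\<Sum>i=2..n. D v) = 0" using D_pow_sum[of 1 "\<lambda>_. v" "{2..n}"] by simp
  then have "D v = 0" using n_ge by (simp add: sum_constant_scaleR)
  then have "(D ^^ Suc (n - 1 + (n - 2))) ?d = 0" by (simp add: v_def funpow_add)
  then have "D ?d = 0" by (rule D_pow_eq_0)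
  moreover have "D (D ?d) = ?d"
    using D_pow_comm[OF d, of 2 x] DDx by (simp add: numeral_2_eq_2)
  ultimately show "\<phi> p * x = x * \<phi> p" by (simp add: D_0 commutator_def)
qed

end

locale lie_n_normal = lie_n +
  assumes phi_p: "\<phi> p \<in> center A"
begin

lemma phi_q: "\<phi> q \<in> center A"
  unfolding q_eq using phi_diff[OF one_in p_in] center_closed(2)[OF phi_one_central phi_p] by simp

lemma lie_n_normal_swap: "lie_n_normal A q p n \<phi>"
  by (intro lie_n_normal.intro lie_n.intro peirce_swap lie_n_axioms.intro lie_n_normal_axioms.intro n_ge lie phi_q)

text \<open>
  Once \<open>\<phi> p\<close> is central, the slots holding \<open>p\<close> contribute nothing to the product rule.
\<close>

lemma phi_D_pcomm:
  assumes m: "1 \<le> m" "m \<le> n" and x: "\<And>i. 1 \<le> i \<Longrightarrow> i \<le> m \<Longrightarrow> x i \<in> A"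
  shows "\<phi> ((D ^^ (n - m)) (pcomm m x)) = (D ^^ (n - m)) (\<Sum>i=1..m. pcomm m (x(i := \<phi> (x i))))"
proof -
  define y where "y = (\<lambda>i. if i \<le> m then x i else p)"
  have yA: "y i \<in> A" if "1 \<le> i" for i using x that by (simp add: y_def closed)
  have tail: "pcomm n w = (D ^^ (n - m)) (pcomm m w)"
    if "\<And>i. m < i \<Longrightarrow> i \<le> n \<Longrightarrow> w i = p" for w
    using pcomm_tail[of m "n - m" w] that m by simp
  have "pcomm n y = (D ^^ (n - m)) (pcomm m x)"
    using pcomm_cong[of m y x] by (subst tail) (auto simp: y_def)
  moreover have "\<phi> (pcomm n y) = (\<Sum>i=1..n. pcomm n (y(i := \<phi> (y i))))"
    by (rule phi_pcomm) (use yA in auto)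
  moreover have "\<dots> = (\<Sum>i=1..m. pcomm n (y(i := \<phi> (y i))))"
  proof (rule sum.mono_neutral_right)
    show "\<forall>i\<in>{1..n} - {1..m}. pcomm n (y(i := \<phi> (y i))) = 0"
    proof
      fix i assume "i \<in> {1..n} - {1..m}"
      then show "pcomm n (y(i := \<phi> (y i))) = 0"
        using n_ge phi_p yA phi_in
        by (intro pcomm_central[of n _ i]) (auto simp: y_def closed)
    qed
  qed (use m in auto)
  moreover have "\<dots> = (\<Sum>i=1..m. (D ^^ (n - m)) (pcomm m (x(i := \<phi> (x i)))))"
  proof (rule sum.cong)
    fix i assume i: "i \<in> {1..m}"
    have "pcomm m (y(i := \<phi> (y i))) = pcomm m (x(i := \<phi> (x i)))"
      by (rule pcomm_cong) (use i in \<open>auto simp: y_def\<close>)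
    then show "pcomm n (y(i := \<phi> (y i))) = (D ^^ (n - m)) (pcomm m (x(i := \<phi> (x i))))"
      using i by (subst tail) (auto simp: y_def)
  qed simp
  ultimately show ?thesis by (simp add: D_pow_sum)
qed

lemma phi_D1: "x \<in> A \<Longrightarrow> \<phi> ((D ^^ (n - 1)) x) = (D ^^ (n - 1)) (\<phi> x)"
  using phi_D_pcomm[of 1 "\<lambda>_. x"] n_ge by simp

lemma phi_D2:
  assumes "x \<in> A" "y \<in> A"
  shows "\<phi> ((D ^^ (n - 2)) (commutator x y)) =
    (D ^^ (n - 2)) (commutator (\<phi> x) y + commutator x (\<phi> y))"
proof -
  have "{1..2::nat} = {1,2}" by auto
  then show ?thesis
    using phi_D_pcomm[of 2 "\<lambda>i. if i = 1 then x else y"] n_ge assms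
    by (simp add: numeral_2_eq_2)
qed

lemma phi_D3:
  assumes "n \<ge> 3" "x \<in> A" "y \<in> A" "z \<in> A"
  shows "\<phi> ((D ^^ (n - 3)) (commutator (commutator x y) z)) =
    (D ^^ (n - 3)) (commutator (commutator (\<phi> x) y + commutator x (\<phi> y)) z + commutator (commutator x y) (\<phi> z))"
proof -
  have "{1..3::nat} = {1,2,3}" by auto
  then show ?thesis
    using phi_D_pcomm[of 3 "\<lambda>i. if i = 1 then x else if i = 2 then y else z"] assms
    by (simp add: numeral_2_eq_2 numeral_3_eq_3 commutator_simps add.assoc)
qed

lemma phi_diag:
  assumes "x \<in> A" "D x = 0" shows "D (\<phi> x) = 0"
proof -
  have n1: "n - 1 = Suc (n - 2)" using n_ge by simp
  have "(D ^^ (n - 1)) x = 0" unfolding n1 funpow_Suc_right using assms by (simp add: D_pow_0)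
  then have "(D ^^ Suc (n - 2)) (\<phi> x) = 0" using phi_D1[OF assms(1)] by (simp only: n1 phi_0)
  then show ?thesis by (rule D_pow_eq_0)
qed

lemma phi_off:
  assumes "x \<in> A" "D (D x) = x" shows "D (D (\<phi> x)) = \<phi> x"
proof -
  let ?M = "D ^^ (n - 1)"
  have MM: "?M (?M y) = (D ^^ (2 * (n - 1))) y" for y by (simp add: mult_2 funpow_add)
  have k: "2 * (n - 1) = Suc (2 * (n - 2) + 1)" using n_ge by simp
  have "x = ?M (?M x)" unfolding MM using D_even[OF assms(2)] by simp
  then have "\<phi> x = ?M (?M (\<phi> x))" using phi_D1 assms D_pow_in by metis
  also have "\<dots> = D ((D ^^ (2 * (n - 2) + 1)) (\<phi> x))" unfolding MM k by simp
  finally show ?thesis using DDD by metis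
qed

lemma off_commutator_diag:
  assumes "D (D x) = x" "D (D y) = y" shows "D (commutator x y) = 0"
proof -
  have *: "x * p = x - p * x" if "D (D x) = x" for x
  proof -
    have x: "x = p * x * q + q * x * p" using that DD[of x] by simp
    have "x * p = q * x * p" "p * x = p * x * q"
      by (subst x, simp add: algebra_simps)+
    then show ?thesis using x by (simp add: algebra_simps)
  qed
  have **: "x * y * p = p * x * y" if "D (D x) = x" "D (D y) = y" for x y
  proof -
    have "x * y * p = x * y - x * p * y"
      by (simp only: mult.assoc *[OF that(2)] right_diff_distrib)
    also have "\<dots> = p * x * y" by (simp add: *[OF that(1)] left_diff_distrib)
    finally show ?thesis .
  qed
  note **[OF assms] moreover note **[OF assms(2,1)]
  ultimately show ?thesis unfolding D_0_iff commutator_def by (simp add: algebra_simps)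
qed

text \<open>
  The image of \<open>z\<close> is off-diagonal; let \<open>v\<close> be its component in the wrong corner \<open>q A p\<close>.  For even
  \<open>n\<close> the map \<open>\<phi>\<close> commutes with \<open>D\<close>, which has different eigenvalues on the two corners.  For odd \<open>n\<close>
  it only commutes with \<open>D \<circ> D\<close>, which does not separate them, and \<open>v\<close> is excluded by a computation:
  for \<open>w = [x, y]\<close> with \<open>x\<close> in \<open>p A q\<close> and \<open>y\<close> in \<open>q A p\<close>, the product rules for \<open>[w, z]\<close> and for
  \<open>[[x, y], z]\<close> give the component of \<open>\<phi> [w, z]\<close> in \<open>q A p\<close> with opposite signs, so \<open>[w, v] = 0\<close>.
  The choice \<open>y = v\<close> yields \<open>v x v = 0\<close>.
\<close>

lemma phi_C_pq:
  assumes z: "z \<in> C p q" shows "\<phi> z \<in> C p q"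
proof -
  define u v where "u = p * \<phi> z * q" and "v = q * \<phi> z * p"
  have zA: "z \<in> A" using z by (rule C_in)
  have DDz: "D (D z) = z" using z by (simp add: D_C D_minus)
  have uv: "\<phi> z = u + v" using phi_off[OF zA DDz] unfolding DD u_def v_def by simp
  have u: "u \<in> C p q" and v: "v \<in> C q p"
    unfolding u_def v_def by (rule C_component; simp add: phi_in zA)+
  have Du: "D u = - u" and Dv: "D v = v" using u v D_C by auto
  have "v = 0"
  proof (cases "even n")
    case True
    have "(D ^^ (n - 1)) y = D y" if "D (D (D y)) = D y" for y
    proof -
      have "n - 1 = Suc (n - 2)" using n_ge by simp
      then have "(D ^^ (n - 1)) y = (D ^^ (n - 2)) (D y)" by (simp add: funpow_swap1)
      then show ?thesis using D_even[of "D y" "n - 2"] True n_ge that by simp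
    qed
    then have "\<phi> (D z) = D (\<phi> z)" using phi_D1[OF zA] DDD by simp
    then have "- (u + v) = v - u" using z zA by (simp add: D_C phi_minus uv D_add Du Dv)
    then have "- v = v" by simp
    then have "v + v = 0" by (metis add.left_inverse)
    then show ?thesis by (simp add: double_eq_0)
  next
    case False
    then have n3: "n \<ge> 3" "even (n - 3)" using n_ge by (auto simp: le_eq_less_or_eq)
    have D3: "(D ^^ (n - 3)) y = y" if "D (D y) = y" for y using D_even[OF that n3(2)] .
    have D2: "(D ^^ (n - 2)) y = D y" if "D (D y) = y" for y
    proof -
      have "n - 2 = Suc (n - 3)" using n3 by simp
      then show ?thesis using D3[OF that] by simp
    qed
    have DDC: "D (D y) = y" if "y \<in> C p q" for y using that by (simp add: D_C D_minus)
    show ?thesis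
    proof (rule semiprime[OF v])
      fix x assume x: "x \<in> C p q"
      have xA: "x \<in> A" and vA: "v \<in> A" using x v C_in by auto
      define w where "w = commutator x v"
      have DDx: "D (D x) = x" "D (D v) = v" using DDC[OF x] Dv by auto
      have w: "w \<in> A" "D w = 0" unfolding w_def using xA vA off_commutator_diag DDx closed by auto
      then have wp: "w * p = p * w" "\<phi> w * p = p * \<phi> w" "\<phi> w \<in> A"
        using phi_diag phi_in by (auto simp: D_0_iff)
      define s where "s = commutator (\<phi> x) v + commutator x (\<phi> v)"
      have s: "s \<in> A" "s * p = p * s"
        using off_commutator_diag[OF phi_off[OF xA DDx(1)] DDx(2)]
          off_commutator_diag[OF DDx(1) phi_off[OF vA DDx(2)]] xA vA
        by (auto simp: s_def closed phi_in D_add simp flip: D_0_iff)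
      have C: "commutator w z \<in> C p q" "commutator w u \<in> C p q" "commutator s z \<in> C p q"
        "commutator (\<phi> w) z \<in> C p q"
        using diag_commutator_C w wp s z u by auto
      have wv: "D (commutator w v) = commutator w v"
        using D_pow_comm[of w 1 v] wp Dv by (simp add: commutator_def D_diff algebra_simps)
      \<comment> \<open>both rules are written in the components \<open>p A q\<close> and \<open>q A p\<close>; only \<open>?c\<close> lies in the latter\<close>
      let ?a = "commutator (\<phi> w) z" and ?b = "commutator w u" and ?c = "commutator w v"
      let ?d = "commutator s z" and ?e = "\<phi> (commutator w z)"
      have wz: "commutator w (\<phi> z) = ?b + ?c" by (simp add: uv commutator_simps)
      have "\<phi> ((D ^^ (n - 2)) (commutator w z)) = (D ^^ (n - 2)) (?a + (?b + ?c))"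
        using phi_D2[OF w(1) zA] by (simp add: wz)
      moreover have "(D ^^ (n - 2)) (commutator w z) = - commutator w z"
        using D2[OF DDC[OF C(1)]] D_C(1)[OF C(1)] by simp
      moreover have "(D ^^ (n - 2)) (?a + (?b + ?c)) = - ?a - ?b + ?c"
        by (subst D2) (simp_all add: D_add D_diff D_minus D_C(1)[OF C(2)] D_C(1)[OF C(4)] wv)
      ultimately have 1: "- ?e = - ?a - ?b + ?c" using w zA by (simp add: phi_minus closed)
      have "\<phi> ((D ^^ (n - 3)) (commutator w z)) = (D ^^ (n - 3)) (?d + (?b + ?c))"
        using phi_D3[OF n3(1) xA vA zA, folded w_def s_def] by (simp only: wz)
      moreover have "(D ^^ (n - 3)) (commutator w z) = commutator w z"
        by (rule D3[OF DDC[OF C(1)]])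
      moreover have "(D ^^ (n - 3)) (?d + (?b + ?c)) = ?d + (?b + ?c)"
        by (rule D3) (simp add: D_add D_diff D_minus D_C(1)[OF C(2)] D_C(1)[OF C(3)] wv)
      ultimately have 2: "?e = ?d + (?b + ?c)" by simp
      have 3: "?c + ?c = ?a - ?d" using 1 unfolding 2 by (simp add: algebra_simps)
      have "?c + ?c = D (?a - ?d)" unfolding 3[symmetric] by (simp add: D_add wv)
      also have "\<dots> = - (?a - ?d)" by (simp add: D_diff D_C(1)[OF C(3)] D_C(1)[OF C(4)])
      finally have "?c + ?c = - (?c + ?c)" unfolding 3 .
      then have "(?c + ?c) + (?c + ?c) = 0" by (metis add.right_inverse)
      then have c0: "?c = 0" by (simp add: double_eq_0)
      have "v * v = 0" using C_mult_0[OF v v] by simp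
      then have "?c = - (v * x * v) - v * x * v"
        unfolding w_def commutator_def
        by (simp add: algebra_simps) (simp add: mult.assoc[symmetric])
      then have "v * x * v = - (v * x * v)" using c0 by (simp add: algebra_simps)
      then have "v * x * v + v * x * v = 0" by (metis add.right_inverse)
      then show "v * x * v = 0" by (simp add: double_eq_0)
    qed
  qed
  then show ?thesis using u uv by simp
qed

end

section \<open>Lie derivations up to central errors\<close>

text \<open>
  A map that preserves the corners and satisfies the Lie product rule up to central errors satisfies
  the associative product rule: on a pair of corners where only one of the two products of the
  bracket survives, the central error lies in an off-diagonal corner and is therefore zero.
\<close>

locale corner_lie = peirce A p q for A :: "'a::{complex_vector,ring,monoid_mult} set" and p q +
  fixes h :: "'a \<Rightarrow> 'a"
  assumes h_add: "x \<in> A \<Longrightarrow> y \<in> A \<Longrightarrow> h (x + y) = h x + h y"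
    and h_C: "a \<in> {p, q} \<Longrightarrow> b \<in> {p, q} \<Longrightarrow> x \<in> C a b \<Longrightarrow> h x \<in> C a b"
    and h_lie: "x \<in> A \<Longrightarrow> y \<in> A \<Longrightarrow>
      h (commutator x y) - commutator (h x) y - commutator x (h y) \<in> center A"
begin

lemma corner_lie_swap: "corner_lie A q p h"
  by (intro corner_lie.intro peirce_swap corner_lie_axioms.intro h_add h_C h_lie) auto

lemma h_0: "h 0 = 0" using h_add[of 0 0] zero_in by simp

lemma h_minus: "x \<in> A \<Longrightarrow> h (- x) = - h x"
  using h_add[of x "- x"] uminus_in h_0 by (simp add: add_eq_0_iff)

lemma h_diff: "x \<in> A \<Longrightarrow> y \<in> A \<Longrightarrow> h (x - y) = h x - h y"
  using h_add[of x "- y"] uminus_in h_minus by simp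

lemma h_Cs:
  "x \<in> C p p \<Longrightarrow> h x \<in> C p p" "x \<in> C p q \<Longrightarrow> h x \<in> C p q"
  "x \<in> C q p \<Longrightarrow> h x \<in> C q p" "x \<in> C q q \<Longrightarrow> h x \<in> C q q"
  by (simp_all add: h_C)

lemma der_pp_pq:
  assumes x: "x \<in> C p p" and z: "z \<in> C p q"
  shows "h (x * z) = h x * z + x * h z"
proof -
  note hx = h_Cs(1)[OF x] and hz = h_Cs(2)[OF z]
  let ?e = "h (x * z) - h x * z - x * h z"
  have "commutator x z = x * z" "commutator (h x) z = h x * z" "commutator x (h z) = x * h z"
    using C_mult_0[OF z x] C_mult_0[OF z hx] C_mult_0[OF hz x] by (simp_all add: commutator_def)
  then have "?e \<in> center A" using h_lie[OF C_in[OF x] C_in[OF z]] by simp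
  moreover have "?e \<in> C p q"
    using C_mult[OF x z] C_mult[OF hx z] C_mult[OF x hz] h_Cs C_diff by auto
  ultimately have "?e = 0" by (rule center_Int_C)
  then show ?thesis by (simp add: algebra_simps)
qed

lemma der_pq_qq:
  assumes z: "z \<in> C p q" and y: "y \<in> C q q"
  shows "h (z * y) = h z * y + z * h y"
proof -
  note hy = h_Cs(4)[OF y] and hz = h_Cs(2)[OF z]
  let ?e = "h (z * y) - h z * y - z * h y"
  have "commutator z y = z * y" "commutator (h z) y = h z * y" "commutator z (h y) = z * h y"
    using C_mult_0[OF y z] C_mult_0[OF hy z] C_mult_0[OF y hz] by (simp_all add: commutator_def)
  then have "?e \<in> center A" using h_lie[OF C_in[OF z] C_in[OF y]] by simp
  moreover have "?e \<in> C p q"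
    using C_mult[OF z y] C_mult[OF hz y] C_mult[OF z hy] h_Cs C_diff by auto
  ultimately have "?e = 0" by (rule center_Int_C)
  then show ?thesis by (simp add: algebra_simps)
qed

text \<open>
  Expanding \<open>h (x y z)\<close> for \<open>z\<close> in \<open>p A q\<close> in two ways, the error for \<open>x y\<close> kills \<open>p A q\<close>.
\<close>

lemma der_pp_pp:
  assumes x: "x \<in> C p p" and y: "y \<in> C p p"
  shows "h (x * y) = h x * y + x * h y"
proof -
  note hx = h_Cs(1)[OF x] and hy = h_Cs(1)[OF y]
  have "h (x * y) - h x * y - x * h y = 0"
  proof (rule annihilate_right)
    show "h (x * y) - h x * y - x * h y \<in> C p p"
      using C_mult[OF x y] C_mult[OF hx y] C_mult[OF x hy] h_Cs C_diff by auto
    fix z assume z: "z \<in> C p q"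
    have "h (x * y) * z + x * y * h z = h (x * (y * z))"
      using der_pp_pq[OF C_mult[OF x y] z] by (simp add: mult.assoc)
    also have "\<dots> = h x * (y * z) + x * (h y * z + y * h z)"
      using der_pp_pq[OF x C_mult[OF y z]] der_pp_pq[OF y z] by simp
    finally show "(h (x * y) - h x * y - x * h y) * z = 0"
      by (simp add: algebra_simps)
  qed
  then show ?thesis by (simp add: algebra_simps)
qed

text \<open>
  Here both products \<open>x y\<close> and \<open>y x\<close> survive, with errors \<open>e\<close> in \<open>p A p\<close> and \<open>f\<close> in \<open>q A q\<close> whose
  difference is central.  Computing \<open>h (x y x)\<close> in two ways gives \<open>e x = x f\<close>, while centrality gives
  \<open>e x = - x f\<close>; so the central element \<open>e - f\<close> kills \<open>x\<close>.
\<close>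

lemma der_pq_qp:
  assumes x: "x \<in> C p q" and y: "y \<in> C q p"
  shows "h (x * y) = h x * y + x * h y"
proof (cases "x = 0")
  case False
  note hx = h_Cs(2)[OF x] and hy = h_Cs(3)[OF y]
  note xy = C_mult[OF x y] and yx = C_mult[OF y x]
  define e f where "e = h (x * y) - h x * y - x * h y" and "f = h (y * x) - h y * x - y * h x"
  have e: "e \<in> C p p" and f: "f \<in> C q q"
    unfolding e_def f_def using xy yx C_mult[OF hx y] C_mult[OF x hy] C_mult[OF hy x] C_mult[OF y hx]
      h_Cs C_diff by auto
  have ef: "e - f \<in> center A"
    using h_lie[OF C_in[OF x] C_in[OF y]] h_diff[OF C_in[OF xy] C_in[OF yx]]
    by (simp add: commutator_def e_def f_def algebra_simps)
  have "h (x * y) * x + x * y * h x = h (x * y * x)"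
    using der_pp_pq[OF xy x] by simp
  also have "\<dots> = h x * (y * x) + x * h (y * x)"
    using der_pq_qq[OF x yx] by (simp add: mult.assoc)
  finally have 1: "e * x = x * f" unfolding e_def f_def by (simp add: algebra_simps)
  have 2: "f * x = 0" "x * e = 0" using C_mult_0[OF f x] C_mult_0[OF x e] by auto
  have "(e - f) * x = x * (e - f)" using ef C_in[OF x] by (rule center_commute)
  then have "e * x = - (x * f)" using 2 by (simp add: algebra_simps)
  then have "x * f + x * f = 0" using 1 by (metis add.right_inverse)
  then have "(e - f) * x = 0" using 1 2 by (simp add: double_eq_0 algebra_simps)
  then have "e - f = 0" using center_mult_eq_0[OF ef C_in[OF x]] False by simp
  then have "p * (e - f) = 0" by simp
  then have "e = 0" using C_simps(1)[OF e] C_annihil(2)[OF f] by (simp add: right_diff_distrib)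
  then show ?thesis unfolding e_def by (simp add: algebra_simps)
qed (simp add: h_0)

lemma der_C:
  assumes "a \<in> {p, q}" "b \<in> {p, q}" "d \<in> {p, q}" "e \<in> {p, q}" "x \<in> C a b" "y \<in> C d e"
  shows "h (x * y) = h x * y + x * h y"
proof (cases "b = d")
  case True
  note sw = corner_lie_swap
  show ?thesis
    using True assms der_pp_pq der_pq_qq der_pp_pp der_pq_qp
      corner_lie.der_pp_pq[OF sw] corner_lie.der_pq_qq[OF sw]
      corner_lie.der_pp_pp[OF sw] corner_lie.der_pq_qp[OF sw]
    by auto
next
  case False
  then have bd: "b * d = 0" using assms by auto
  have "x * y = 0" "h x * y = 0" "x * h y = 0"
    using C_mult_0[OF assms(5,6) bd] C_mult_0[OF h_C[OF assms(1,2,5)] assms(6) bd]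
      C_mult_0[OF assms(5) h_C[OF assms(3,4,6)] bd] by auto
  then show ?thesis by (simp add: h_0)
qed

lemma corner_lie_derivation:
  assumes x: "x \<in> A" and y: "y \<in> A"
  shows "h (x * y) = h x * y + x * h y"
proof -
  have addl: "h ((u + v) * w) = h (u + v) * w + (u + v) * h w"
    if "u \<in> A" "v \<in> A" "w \<in> A" "h (u * w) = h u * w + u * h w" "h (v * w) = h v * w + v * h w" for u v w
    using that by (simp add: h_add closed algebra_simps)
  have addr: "h (w * (u + v)) = h w * (u + v) + w * h (u + v)"
    if "u \<in> A" "v \<in> A" "w \<in> A" "h (w * u) = h w * u + w * h u" "h (w * v) = h w * v + w * h v" for u v w
    using that by (simp add: h_add closed algebra_simps)
  have *: "h (u * y) = h u * y + u * h y" if u: "u \<in> C a b" "a \<in> {p, q}" "b \<in> {p, q}" for u a b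
  proof -
    have uA: "u \<in> A" using u C_in by blast
    have "h (u * (p * y * p + p * y * q + q * y * p + q * y * q)) =
      h u * (p * y * p + p * y * q + q * y * p + q * y * q)
      + u * h (p * y * p + p * y * q + q * y * p + q * y * q)"
      by (intro addr closed y uA) (rule der_C[OF u(2,3) _ _ u(1) C_component[OF y]]; simp)+
    then show ?thesis by (simp only: peirce_decomp[symmetric])
  qed
  have "h ((p * x * p + p * x * q + q * x * p + q * x * q) * y) =
    h (p * x * p + p * x * q + q * x * p + q * x * q) * y
    + (p * x * p + p * x * q + q * x * p + q * x * q) * h y"
    by (intro addl closed x y) (rule *[OF C_component[OF x]]; simp)+
  then show ?thesis by (simp only: peirce_decomp[symmetric])
qed

end

section \<open>Splitting off the central part\<close>

context lie_n_normal
begin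

lemma phi_C_qp: "z \<in> C q p \<Longrightarrow> \<phi> z \<in> C q p"
  by (rule lie_n_normal.phi_C_pq[OF lie_n_normal_swap])

lemma phi_D: assumes x: "x \<in> A" shows "\<phi> (D x) = D (\<phi> x)"
proof -
  define a b d where "a = p * x * q" and "b = q * x * p" and "d = p * x * p + q * x * q"
  have a: "a \<in> C p q" and b: "b \<in> C q p" and dA: "d \<in> A"
    unfolding a_def b_def d_def using C_component[OF x] x closed by auto
  have aA: "a \<in> A" and bA: "b \<in> A" using a b C_in by auto
  have Dd: "D d = 0" unfolding D_0_iff d_def by (simp add: algebra_simps)
  have x_eq: "x = d + a + b" using peirce_decomp[of x] by (simp add: a_def b_def d_def algebra_simps)
  have "\<phi> (D x) = \<phi> (b - a)" unfolding x_eq by (simp add: D_add D_C(1)[OF a] D_C(2)[OF b] Dd)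
  also have "\<dots> = \<phi> b - \<phi> a" using aA bA by (rule phi_diff[rotated])
  also have "\<dots> = D (\<phi> d) + D (\<phi> a) + D (\<phi> b)"
    using D_C(1)[OF phi_C_pq[OF a]] D_C(2)[OF phi_C_qp[OF b]] phi_diag[OF dA Dd] by simp
  also have "\<dots> = D (\<phi> x)" unfolding x_eq using aA bA dA by (simp add: phi_add closed D_add)
  finally show ?thesis .
qed

lemma phi_D_pow': "x \<in> A \<Longrightarrow> \<phi> ((D ^^ k) x) = (D ^^ k) (\<phi> x)"
  by (induction k) (auto simp: phi_D D_pow_in)

text \<open>
  Let \<open>\<delta> x y\<close> be the failure of the Lie product rule; it is \<open>0\<close> for \<open>n = 2\<close>.  For
  \<open>n \<ge> 3\<close> the rule for two free slots shows that it is
  diagonal for all \<open>x\<close> and \<open>y\<close>.  In the rule for three free slots with last argument \<open>z\<close> in \<open>p A q\<close>, the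
  error is \<open>[\<delta> x y, z]\<close> plus the diagonal element \<open>\<delta> [x, y] z\<close>, so its off-diagonal part shows that
  \<open>\<delta> x y\<close> commutes with \<open>p A q\<close>.
\<close>

lemma phi_lie_central:
  assumes x: "x \<in> A" and y: "y \<in> A"
  shows "\<phi> (commutator x y) - commutator (\<phi> x) y - commutator x (\<phi> y) \<in> center A"
proof (cases "n = 2")
  case True
  then show ?thesis using phi_D2[OF x y] by (simp add: center_closed)
next
  case False
  then have n3: "n \<ge> 3" using n_ge by simp
  define \<delta> where "\<delta> x y = \<phi> (commutator x y) - commutator (\<phi> x) y - commutator x (\<phi> y)" for x y
  have A: "\<delta> x y \<in> A" if "x \<in> A" "y \<in> A" for x y
    unfolding \<delta>_def using that by (simp add: closed phi_in)
  have n2: "n - 2 = Suc (n - 3)" using n3 by simp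
  have diag: "D (\<delta> x y) = 0" if xy: "x \<in> A" "y \<in> A" for x y
  proof (rule D_pow_eq_0)
    show "(D ^^ Suc (n - 3)) (\<delta> x y) = 0"
      using phi_D2[OF xy] xy unfolding n2[symmetric] \<delta>_def
      by (simp add: phi_D_pow' closed D_pow_diff D_pow_add)
  qed
  have "\<delta> x y \<in> center A"
  proof (rule diag_central)
    show "\<delta> x y \<in> A" by (rule A[OF x y])
    show dp: "\<delta> x y * p = p * \<delta> x y" using diag[OF x y] by (simp add: D_0_iff)
    fix z assume z: "z \<in> C p q"
    have zA: "z \<in> A" using z by (rule C_in)
    let ?w = "commutator x y"
    have "commutator (\<delta> x y) z + \<delta> ?w z =
      \<phi> (commutator ?w z) - (commutator (commutator (\<phi> x) y + commutator x (\<phi> y)) z + commutator ?w (\<phi> z))"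
      by (simp add: \<delta>_def commutator_simps)
    then have "(D ^^ (n - 3)) (commutator (\<delta> x y) z + \<delta> ?w z) = 0"
      using phi_D3[OF n3 x y zA] x y zA by (simp add: phi_D_pow' closed D_pow_diff)
    then have "(D ^^ (n - 2)) (commutator (\<delta> x y) z + \<delta> ?w z) = 0"
      by (simp add: n2 D_0)
    moreover have "(D ^^ (n - 2)) (\<delta> ?w z) = 0"
      unfolding n2 funpow_Suc_right using diag[of ?w z] x y zA by (simp add: closed D_pow_0)
    ultimately have "(D ^^ (n - 2)) (commutator (\<delta> x y) z) = 0" by (simp add: D_pow_add)
    then have "commutator (\<delta> x y) z = 0"
      using C_D_pow_eq_0 diag_commutator_C[OF A[OF x y] dp z] by blast
    then show "\<delta> x y * z = z * \<delta> x y" by (simp add: commutator_def)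
  qed
  then show ?thesis by (simp add: \<delta>_def)
qed

text \<open>
  For \<open>y\<close> in \<open>q A q\<close> one has \<open>[x, y] = 0\<close>, so with \<open>b = q (\<phi> x) q\<close> the commutator \<open>[b, y]\<close> is \<open>z q\<close>
  for a central \<open>z\<close>.  A commutator cannot be a non-zero central element here: replacing \<open>y\<close> by \<open>y b\<close>
  shows that \<open>z b\<close> is a central multiple of \<open>q\<close> as well, whence \<open>z [b, y] = 0\<close> and \<open>z\<^sup>2 q = 0\<close>.
\<close>

lemma opposite_corner_central:
  assumes x: "x \<in> C p p"
  shows "\<exists>z\<in>center A. q * \<phi> x * q = z * q"
proof (rule center_q)
  let ?b = "q * \<phi> x * q"
  have xA: "x \<in> A" using x by (rule C_in)
  show "?b \<in> A" "q * ?b = ?b" "?b * q = ?b" using xA by (simp_all add: closed phi_in mult.assoc)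
  have ex: "\<exists>z\<in>center A. commutator ?b y = z * q" if y: "y \<in> C q q" for y
  proof -
    have yA: "y \<in> A" using y by (rule C_in)
    define z where "z = \<phi> (commutator x y) - commutator (\<phi> x) y - commutator x (\<phi> y)"
    have z: "z \<in> center A" unfolding z_def using xA yA by (rule phi_lie_central)
    have "commutator x y = 0" using C_mult_0[OF x y] C_mult_0[OF y x] by (simp add: commutator_def)
    then have z_eq: "z = - commutator (\<phi> x) y - commutator x (\<phi> y)" by (simp add: z_def phi_0)
    have yq: "q * (y * u) = y * u" "y * q = y" "q * y = y" "y * (q * u) = y * u" for u
      using C_simps(2)[OF y] C_simps(4)[OF y] by (simp_all add: mult.assoc[symmetric])
    have xq: "q * (x * u) = 0" "x * q = 0" for u
      using C_annihil(1)[OF x] C_annihil(3)[OF x] by (simp_all add: mult.assoc[symmetric])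
    have "z * q = q * z * q" using center_commute[OF z q_in] by (simp add: mult.assoc)
    also have "\<dots> = - commutator ?b y"
      unfolding z_eq commutator_def
      by (simp add: algebra_simps yq xq)
    finally have "commutator ?b y = (- z) * q" by simp
    then show ?thesis using center_closed(3)[OF z] by blast
  qed
  fix y assume y: "y \<in> A" "q * y = y" "y * q = y"
  then have yC: "y \<in> C q q" by (simp add: C_def)
  have bC: "?b \<in> C q q" using C_component[OF phi_in[OF xA]] by simp
  obtain z where z: "z \<in> center A" "commutator ?b y = z * q" using ex[OF yC] by blast
  obtain z' where z': "z' \<in> center A" "commutator ?b (y * ?b) = z' * q"
    using ex[OF C_mult[OF yC bC]] by blast
  have "z' * q = commutator ?b y * ?b"
    unfolding z'(2)[symmetric] commutator_def by (simp only: mult.assoc left_diff_distrib)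
  also have "\<dots> = z * ?b" using z(2) by (simp add: mult.assoc)
  finally have zb: "z * ?b = z' * q" by simp
  have "z * (z * q) = z * (?b * y) - z * (y * ?b)"
    using z(2) by (simp only: commutator_def right_diff_distrib flip: z(2))
  also have "z * (y * ?b) = y * (z * ?b)"
    using center_commute[OF z(1) y(1)] by (simp only: mult.assoc[symmetric])
  also have "z * (?b * y) = z' * q * y" unfolding zb[symmetric] by (simp only: mult.assoc)
  also have "z' * q * y - y * (z * ?b) = z' * y - y * z'"
  proof -
    have "z' * q * y = z' * y" using y(2) by (simp add: mult.assoc)
    moreover have "y * (z' * q) = y * z'"
      unfolding center_commute[OF z'(1) q_in] using y(3) by (simp add: mult.assoc[symmetric])
    ultimately show ?thesis by (simp only: zb)
  qed
  also have "\<dots> = 0" using center_commute[OF z'(1) y(1)] by simp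
  finally have "z * (z * q) = 0" .
  then have "z = 0 \<or> z * q = 0"
    using center_mult_eq_0[OF z(1)] closed center_in[OF z(1)] by blast
  then have "commutator ?b y = 0" using z by auto
  then show "?b * y = y * ?b" by (simp add: commutator_def)
qed

text \<open>
  The central \<open>z\<close> for which the component in the corner of \<open>b\<close> of the image of the \<open>a\<close>-corner of \<open>x\<close>
  is \<open>z b\<close>.  Taking \<open>a\<close> and \<open>b\<close> as arguments lets one definition serve both orders of \<open>p\<close> and \<open>q\<close>.
\<close>

definition opposite_scalar :: "'a \<Rightarrow> 'a \<Rightarrow> 'a \<Rightarrow> 'a" where
  "opposite_scalar a b x = (THE z. z \<in> center A \<and> b * \<phi> (a * x * a) * b = z * b)"

lemma opposite_scalar_eq:
  assumes "z \<in> center A" "q * \<phi> (p * x * p) * q = z * q"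
  shows "opposite_scalar p q x = z"
  unfolding opposite_scalar_def
proof (rule the_equality)
  fix y assume y: "y \<in> center A \<and> q * \<phi> (p * x * p) * q = y * q"
  then have "(y - z) * q = 0" using assms by (simp add: left_diff_distrib)
  then show "y = z"
    using center_mult_eq_0[OF center_closed(2)] y assms(1) q_in q_nz by fastforce
qed (use assms in auto)

lemma opposite_scalar:
  assumes "x \<in> A"
  shows "opposite_scalar p q x \<in> center A" "q * \<phi> (p * x * p) * q = opposite_scalar p q x * q"
proof -
  have "p * x * p \<in> C p p" using C_component[OF assms] by simp
  from opposite_corner_central[OF this]
  obtain z where "z \<in> center A" "q * \<phi> (p * x * p) * q = z * q" by blast
  moreover from this have "opposite_scalar p q x = z" by (rule opposite_scalar_eq)
  ultimately show "opposite_scalar p q x \<in> center A" "q * \<phi> (p * x * p) * q = opposite_scalar p q x * q" by simp_all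
qed

lemma opposite_scalar_add:
  assumes "x \<in> A" "y \<in> A" shows "opposite_scalar p q (x + y) = opposite_scalar p q x + opposite_scalar p q y"
proof (rule opposite_scalar_eq)
  have "q * \<phi> (p * (x + y) * p) * q = q * \<phi> (p * x * p) * q + q * \<phi> (p * y * p) * q"
    using assms by (simp add: distrib_left distrib_right phi_add closed)
  then show "q * \<phi> (p * (x + y) * p) * q = (opposite_scalar p q x + opposite_scalar p q y) * q"
    by (simp only: opposite_scalar(2)[OF assms(1)] opposite_scalar(2)[OF assms(2)] distrib_right)
qed (simp add: assms center_closed opposite_scalar)

lemma opposite_scalar_scale:
  assumes "x \<in> A" shows "opposite_scalar p q (c *\<^sub>C x) = c *\<^sub>C opposite_scalar p q x"
proof (rule opposite_scalar_eq)
  have "q * \<phi> (p * (c *\<^sub>C x) * p) * q = c *\<^sub>C (q * \<phi> (p * x * p) * q)"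
    using assms by (simp add: scale_mult_left scale_mult_right phi_scale closed phi_in)
  then show "q * \<phi> (p * (c *\<^sub>C x) * p) * q = (c *\<^sub>C opposite_scalar p q x) * q"
    using center_in[OF opposite_scalar(1)[OF assms]]
    by (simp only: opposite_scalar(2)[OF assms] scale_mult_left q_in)
qed (simp add: assms center_closed opposite_scalar)

lemma opposite_scalar_0: "p * x * p = 0 \<Longrightarrow> opposite_scalar p q x = 0"
  by (rule opposite_scalar_eq) (simp_all add: center_closed phi_0)

lemmas opposite_scalar_swap = lie_n_normal.opposite_scalar[OF lie_n_normal_swap]
  lie_n_normal.opposite_scalar_add[OF lie_n_normal_swap] lie_n_normal.opposite_scalar_scale[OF lie_n_normal_swap]
  lie_n_normal.opposite_scalar_0[OF lie_n_normal_swap]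

definition central_part :: "'a \<Rightarrow> 'a" where "central_part x = opposite_scalar p q x + opposite_scalar q p x"
definition der_part :: "'a \<Rightarrow> 'a" where "der_part x = \<phi> x - central_part x"

lemma central_part_linear: "clinear_on A (center A) central_part"
  unfolding clinear_on_def central_part_def
  by (auto simp: opposite_scalar opposite_scalar_swap opposite_scalar_add opposite_scalar_scale center_closed scaleC_add_right)

lemma der_part_pp: assumes x: "x \<in> C p p" shows "der_part x \<in> C p p"
proof -
  have xA: "x \<in> A" using x by (rule C_in)
  let ?z = "opposite_scalar p q x"
  have z: "?z \<in> center A" by (rule opposite_scalar[OF xA])
  have pxp: "p * x * p = x" using x by (simp add: C_def)
  have "q * x * q = 0" using C_annihil(1)[OF x] by simp
  then have "central_part x = ?z" unfolding central_part_def using opposite_scalar_swap(5) by simp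
  moreover have "?z = ?z * p + ?z * q" using pq_sum by (simp flip: distrib_left)
  moreover have "q * \<phi> x * q = ?z * q" using opposite_scalar(2)[OF xA] by (simp add: pxp)
  moreover have "\<phi> x = p * \<phi> x * p + q * \<phi> x * q"
  proof -
    have "D x = 0" using C_simps(1)[OF x] C_simps(3)[OF x] by (simp add: D_0_iff)
    then have "\<phi> x * p = p * \<phi> x" using phi_diag[OF xA] by (simp add: D_0_iff)
    then have "p * \<phi> x * q = 0" "q * \<phi> x * p = 0"
      by (metis idem_simps mult.assoc mult_zero_right mult_zero_left)+
    then show ?thesis using peirce_decomp[of "\<phi> x"] by simp
  qed
  ultimately have "der_part x = p * \<phi> x * p - ?z * p" unfolding der_part_def by (metis add.commute add_diff_cancel_right)
  moreover have "?z * p \<in> C p p"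
    using center_commute[OF z p_in] center_in[OF z] by (simp add: C_def closed mult.assoc)
  ultimately show ?thesis using C_component[OF phi_in[OF xA]] C_diff by simp
qed

lemma der_part_pq: assumes x: "x \<in> C p q" shows "der_part x \<in> C p q"
proof -
  have "p * x * p = 0" "q * x * q = 0" using C_annihil(4,1) x by (auto simp: mult.assoc)
  then have "central_part x = 0" unfolding central_part_def using opposite_scalar_0 opposite_scalar_swap(5) by simp
  then show ?thesis using phi_C_pq[OF x] by (simp add: der_part_def)
qed

lemma der_part_swap: "lie_n_normal.der_part A q p \<phi> = der_part"
  by (rule ext) (simp add: der_part_def central_part_def lie_n_normal.der_part_def[OF lie_n_normal_swap] lie_n_normal.central_part_def[OF lie_n_normal_swap] add.commute)

lemmas der_part_qq = lie_n_normal.der_part_pp[OF lie_n_normal_swap, unfolded der_part_swap]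
lemmas der_part_qp = lie_n_normal.der_part_pq[OF lie_n_normal_swap, unfolded der_part_swap]

lemma central_part_central: "x \<in> A \<Longrightarrow> central_part x \<in> center A"
  using central_part_linear by (auto simp: clinear_on_def)

lemma der_part_linear: "clinear_on A A der_part"
  using central_part_linear center_in
  unfolding clinear_on_def der_part_def
  by (auto simp: closed phi_in phi_add phi_scale complex_vector.scale_right_diff_distrib)

lemma corner_lie_der_part: "corner_lie A p q der_part"
proof (intro corner_lie.intro corner_lie_axioms.intro)
  show "peirce A p q" by unfold_locales
  show "der_part (x + y) = der_part x + der_part y" if "x \<in> A" "y \<in> A" for x y
    using that der_part_linear by (simp add: clinear_on_def)
  show "der_part x \<in> C a b" if "a \<in> {p, q}" "b \<in> {p, q}" "x \<in> C a b" for a b x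
    using that der_part_pp der_part_pq der_part_qq der_part_qp by auto
  show "der_part (commutator x y) - commutator (der_part x) y - commutator x (der_part y) \<in> center A"
    if xy: "x \<in> A" "y \<in> A" for x y
  proof -
    have 0: "commutator (central_part x) y = 0" "commutator x (central_part y) = 0"
      using center_commute[OF central_part_central] xy by (simp_all add: commutator_def)
    have "der_part (commutator x y) - commutator (der_part x) y - commutator x (der_part y) =
      (\<phi> (commutator x y) - commutator (\<phi> x) y - commutator x (\<phi> y)) - central_part (commutator x y)"
      by (simp add: der_part_def commutator_simps 0)
    then show ?thesis
      using phi_lie_central[OF xy] central_part_central[OF commutator_in[OF xy]] center_closed(2) by simp
  qed
qed

lemma der_part_derivation: "derivation_on A der_part"
  unfolding derivation_on_def using der_part_linear corner_lie.corner_lie_derivation[OF corner_lie_der_part] by blast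

end

lemma pcomm_sum_upd:
  fixes x :: "nat \<Rightarrow> 'a::ring"
  assumes "1 \<le> i" "i \<le> m"
  shows "pcomm m (x(i := a + b)) = pcomm m (x(i := a)) + pcomm m (x(i := b))"
  using assms
proof (induction m x rule: pcomm.induct)
  case (3 m x)
  show ?case
  proof (cases "i = Suc (Suc m)")
    case True
    have "pcomm (Suc m) (x(Suc (Suc m) := c)) = pcomm (Suc m) x" for c
      by (rule pcomm_cong) auto
    then show ?thesis unfolding True pcomm.simps fun_upd_same by (simp only: commutator_simps)
  next
    case False
    then show ?thesis using 3 by (simp add: commutator_simps)
  qed
qed auto

context peirce
begin

lemma derivation_pcomm:
  assumes h: "derivation_on A h" and "m \<ge> 1" and "\<And>i. 1 \<le> i \<Longrightarrow> i \<le> m \<Longrightarrow> x i \<in> A"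
  shows "h (pcomm m x) = (\<Sum>i=1..m. pcomm m (x(i := h (x i))))"
  using assms(2,3)
proof (induction m x rule: pcomm.induct)
  case (3 m x)
  let ?k = "Suc (Suc m)"
  have hA: "h u \<in> A" if "u \<in> A" for u
    using h that by (auto simp: derivation_on_def clinear_on_def)
  have hd: "h (u - v) = h u - h v" if "u \<in> A" "v \<in> A" for u v
  proof -
    have "h (u + (-1) *\<^sub>C v) = h u + (-1) *\<^sub>C h v"
      using h that scale_in unfolding derivation_on_def clinear_on_def by metis
    then show ?thesis by (simp add: scaleC_one)
  qed
  have hc: "h (commutator u v) = commutator (h u) v + commutator u (h v)" if "u \<in> A" "v \<in> A" for u v
  proof -
    have "h (u * v) = h u * v + u * h v" "h (v * u) = h v * u + v * h u"
      using h that by (simp_all add: derivation_on_def)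
    then show ?thesis
      using hd[OF mult_in mult_in, of u v v u] that by (simp add: commutator_def algebra_simps)
  qed
  have inA: "pcomm (Suc m) x \<in> A" "x ?k \<in> A" using 3(3) by (auto intro: pcomm_in)
  have "h (pcomm ?k x) = commutator (h (pcomm (Suc m) x)) (x ?k) + commutator (pcomm (Suc m) x) (h (x ?k))"
    using hc[OF inA] by simp
  also have "h (pcomm (Suc m) x) = (\<Sum>i=1..Suc m. pcomm (Suc m) (x(i := h (x i))))"
    by (rule 3(1)) (use 3(3) in auto)
  also have "commutator \<dots> (x ?k) = (\<Sum>i=1..Suc m. commutator (pcomm (Suc m) (x(i := h (x i)))) (x ?k))"
    by (simp add: commutator_def sum_distrib_left sum_distrib_right sum_subtractf distrib_left distrib_right)
  also have "\<dots> = (\<Sum>i=1..Suc m. pcomm ?k (x(i := h (x i))))"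
    by (rule sum.cong) auto
  also have "commutator (pcomm (Suc m) x) (h (x ?k)) = pcomm ?k (x(?k := h (x ?k)))"
    using pcomm_cong[of "Suc m" "x(?k := h (x ?k))" x] by simp
  also have "(\<Sum>i=1..Suc m. pcomm ?k (x(i := h (x i)))) + \<dots> = (\<Sum>i=1..?k. pcomm ?k (x(i := h (x i))))"
    by (subst sum.nat_ivl_Suc'[of 1 "Suc m"]) (auto simp only: add.commute)
  finally show ?case .
qed auto

end

context lie_n_normal
begin

lemma normal_standard: "standard n A \<phi>"
  unfolding standard_def
proof (intro exI conjI allI impI ballI)
  show "derivation_on A der_part" by (rule der_part_derivation)
  show "clinear_on A (center A) central_part" by (rule central_part_linear)
  show "\<phi> x = der_part x + central_part x" for x by (simp add: der_part_def)
  fix x assume x: "\<forall>i\<in>{1..n}. x i \<in> A"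
  have "\<phi> (pcomm n x) = (\<Sum>i=1..n. pcomm n (x(i := \<phi> (x i))))"
    by (rule phi_pcomm) (use x in auto)
  also have "\<dots> = (\<Sum>i=1..n. pcomm n (x(i := der_part (x i))))"
  proof (rule sum.cong)
    fix i assume i: "i \<in> {1..n}"
    have "pcomm n (x(i := \<phi> (x i))) = pcomm n (x(i := der_part (x i))) + pcomm n (x(i := central_part (x i)))"
      using pcomm_sum_upd[of i n x "der_part (x i)" "central_part (x i)"] i by (simp add: der_part_def)
    also have "pcomm n (x(i := central_part (x i))) = 0"
      using x i n_ge central_part_central center_in by (intro pcomm_central[of n _ i]) auto
    finally show "pcomm n (x(i := \<phi> (x i))) = pcomm n (x(i := der_part (x i)))"
      by (simp only: add_0_right)
  qed simp
  also have "\<dots> = der_part (pcomm n x)"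
    using derivation_pcomm[OF der_part_derivation, of n x] x n_ge by simp
  finally show "central_part (pcomm n x) = 0" by (simp add: der_part_def)
qed

end

context peirce
begin

lemma inner_derivation: "u \<in> A \<Longrightarrow> derivation_on A (\<lambda>x. commutator x u)"
  unfolding derivation_on_def clinear_on_def commutator_def
  by (auto simp: closed algebra_simps scale_mult_left scale_mult_right complex_vector.scale_right_diff_distrib)

end

context lie_n
begin

text \<open>
  The bracket with \<open>u = D (\<phi> p)\<close> is an inner derivation, and adding it to \<open>\<phi>\<close> removes the
  off-diagonal part \<open>D (D (\<phi> p))\<close> of \<open>\<phi> p\<close>.
\<close>

theorem lie_n_standard: "standard n A \<phi>"
proof -
  define u where "u = D (\<phi> p)"
  define \<psi> where "\<psi> x = \<phi> x + commutator x u" for x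
  have u: "u \<in> A" by (simp add: u_def D_in phi_in p_in)
  note in_der = inner_derivation[OF u]
  have lin: "clinear_on A A \<psi>"
    using in_der unfolding derivation_on_def clinear_on_def \<psi>_def
    by (auto simp: closed phi_in phi_add phi_scale u scaleC_add_right)
  have "lie_n_derivation n A \<psi>"
    unfolding lie_n_derivation_def
  proof (intro conjI lin allI impI)
    fix x assume x: "\<forall>i\<in>{1..n}. x i \<in> A"
    have "\<psi> (pcomm n x) = (\<Sum>i=1..n. pcomm n (x(i := \<phi> (x i))) + pcomm n (x(i := commutator (x i) u)))"
      unfolding \<psi>_def sum.distrib using phi_pcomm[of x] derivation_pcomm[OF in_der, of n x] x n_ge by simp
    also have "\<dots> = (\<Sum>i=1..n. pcomm n (x(i := \<psi> (x i))))"
      unfolding \<psi>_def by (rule sum.cong) (simp_all add: pcomm_sum_upd)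
    finally show "\<psi> (pcomm n x) = (\<Sum>i=1..n. pcomm n (x(i := \<psi> (x i))))" .
  qed
  then interpret psi: lie_n A p q n \<psi> using n_ge by unfold_locales
  have "commutator p u = - D u" by (simp add: D_def commutator_def)
  then have "D (\<psi> p) = 0" by (simp add: \<psi>_def D_add D_diff D_minus u_def DDD)
  then have "\<psi> p \<in> center A" using psi.phi_p_central by (simp add: D_0_iff)
  then interpret psi: lie_n_normal A p q n \<psi> by unfold_locales
  obtain h t where ht: "derivation_on A h" "clinear_on A (center A) t"
    "\<And>x. (\<forall>i\<in>{1..n}. x i \<in> A) \<Longrightarrow> t (pcomm n x) = 0" "\<And>x. x \<in> A \<Longrightarrow> \<psi> x = h x + t x"
    using psi.normal_standard unfolding standard_def by metis
  have "h x \<in> A" if "x \<in> A" for x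
    using ht(1) that by (auto simp: derivation_on_def clinear_on_def)
  then have "derivation_on A (\<lambda>x. h x - commutator x u)"
    using ht(1) in_der u unfolding derivation_on_def clinear_on_def
    by (auto simp: diff_in commutator_in algebra_simps complex_vector.scale_right_diff_distrib)
  moreover have "\<phi> x = (h x - commutator x u) + t x" if "x \<in> A" for x
    using ht(4)[OF that] by (simp add: \<psi>_def algebra_simps)
  ultimately show ?thesis unfolding standard_def using ht(2,3) by blast
qed

end

section \<open>Hilbert spaces: projections and adjoints\<close>

lemma cinner_simps:
  fixes x y z :: "'h::complex_hilbert_space"
  shows "cinner (x + y) z = cinner x z + cinner y z"
    "cinner x (y + z) = cinner x y + cinner x z"
    "cinner (x - y) z = cinner x z - cinner y z"
    "cinner x (y - z) = cinner x y - cinner x z"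
    "cinner (a *\<^sub>C x) y = a * cinner x y"
    "cinner x (a *\<^sub>C y) = cnj a * cinner x y"
    "cinner 0 x = 0" "cinner x 0 = 0"
proof -
  have addr: "cinner x (y + z) = cinner x y + cinner x z" for x y z :: 'h
    using cinner_commute cinner_add_left complex_cnj_add by metis
  show "cinner (x + y) z = cinner x z + cinner y z" "cinner (a *\<^sub>C x) y = a * cinner x y"
    by (fact cinner_add_left cinner_scaleC_left)+
  show "cinner x (y + z) = cinner x y + cinner x z" by (rule addr)
  show "cinner x (a *\<^sub>C y) = cnj a * cinner x y"
    using cinner_commute cinner_scaleC_left complex_cnj_mult by metis
  show "cinner (x - y) z = cinner x z - cinner y z"
    using cinner_add_left[of "x - y" y z] by simp
  show "cinner x (y - z) = cinner x y - cinner x z"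
    using addr[of x "y - z" z] by simp
  show "cinner 0 x = 0" using cinner_add_left[of 0 0 x] by simp
  show "cinner x 0 = 0" using addr[of x 0 0] by simp
qed

lemma norm_sq: "(norm x)\<^sup>2 = Re (cinner x (x::'h::complex_hilbert_space))"
  by (simp add: cinner_self)

lemma cinner_0_iff: "cinner x x = 0 \<longleftrightarrow> x = (0::'h::complex_hilbert_space)"
  by (simp add: cinner_self)

lemma cinner_ext:
  fixes x y :: "'h::complex_hilbert_space"
  assumes "\<And>z. cinner x z = cinner y z" shows "x = y"
proof -
  have "cinner (x - y) (x - y) = 0" using assms by (simp add: cinner_simps)
  then show ?thesis by (simp add: cinner_0_iff)
qed

lemma norm_sq_diff:
  fixes x y :: "'h::complex_hilbert_space"
  shows "(norm (x - y))\<^sup>2 = (norm x)\<^sup>2 + (norm y)\<^sup>2 - 2 * Re (cinner x y)"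
proof -
  have "Re (cinner y x) = Re (cinner x y)" by (subst cinner_commute) simp
  then show ?thesis by (simp add: norm_sq cinner_simps)
qed

lemma norm_sq_add:
  fixes x y :: "'h::complex_hilbert_space"
  shows "(norm (x + y))\<^sup>2 = (norm x)\<^sup>2 + (norm y)\<^sup>2 + 2 * Re (cinner x y)"
proof -
  have "Re (cinner y x) = Re (cinner x y)" by (subst cinner_commute) simp
  then show ?thesis by (simp add: norm_sq cinner_simps)
qed

lemma parallelogram:
  fixes x y :: "'h::complex_hilbert_space"
  shows "(norm (x + y))\<^sup>2 + (norm (x - y))\<^sup>2 = 2 * (norm x)\<^sup>2 + 2 * (norm y)\<^sup>2"
  by (simp add: norm_sq_add norm_sq_diff)

lemma norm_scaleC: "norm (c *\<^sub>C x) = cmod c * norm (x::'h::complex_hilbert_space)"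
proof -
  have "complex_of_real ((norm (c *\<^sub>C x))\<^sup>2) = c * cnj c * cinner x x"
    by (simp only: cinner_self[symmetric] cinner_simps mult.assoc mult.left_commute)
  also have "\<dots> = complex_of_real ((cmod c * norm x)\<^sup>2)"
    by (simp add: complex_norm_square[symmetric] cinner_self power_mult_distrib)
  finally have "(norm (c *\<^sub>C x))\<^sup>2 = (cmod c * norm x)\<^sup>2"
    using of_real_eq_iff by blast
  then show ?thesis by (simp add: power2_eq_iff_nonneg)
qed

text \<open>
  Removing from \<open>x\<close> its component along \<open>y\<close>.  Non-negativity of the left-hand side is the
  Cauchy-Schwarz inequality, and the strict decrease for \<open>cinner x y \<noteq> 0\<close> shows that a nearest point
  of a subspace is an orthogonal projection.
\<close>

lemma norm_sq_minus_component:
  fixes x y :: "'h::complex_hilbert_space"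
  assumes "y \<noteq> 0"
  shows "(norm (x - (cinner x y / (norm y)\<^sup>2) *\<^sub>C y))\<^sup>2 = (norm x)\<^sup>2 - (cmod (cinner x y))\<^sup>2 / (norm y)\<^sup>2"
proof -
  define c where "c = cinner x y / (norm y)\<^sup>2"
  have "(norm (x - c *\<^sub>C y))\<^sup>2 = (norm x)\<^sup>2 + (cmod c)\<^sup>2 * (norm y)\<^sup>2 - 2 * Re (cnj c * cinner x y)"
    by (simp add: norm_sq_diff norm_scaleC power_mult_distrib cinner_simps)
  also have "cnj c * cinner x y = complex_of_real ((cmod (cinner x y))\<^sup>2 / (norm y)\<^sup>2)"
    using complex_norm_square[of "cinner x y"] by (simp add: c_def mult.commute)
  also have "(cmod c)\<^sup>2 * (norm y)\<^sup>2 = (cmod (cinner x y))\<^sup>2 / (norm y)\<^sup>2"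
    using assms by (simp add: c_def norm_divide norm_mult power2_eq_square)
  finally show ?thesis by (simp add: c_def)
qed

lemma cinner_Cauchy_Schwarz:
  fixes x y :: "'h::complex_hilbert_space"
  shows "cmod (cinner x y) \<le> norm x * norm y"
proof (cases "y = 0")
  case False
  have "0 \<le> (norm x)\<^sup>2 - (cmod (cinner x y))\<^sup>2 / (norm y)\<^sup>2"
    unfolding norm_sq_minus_component[OF False, symmetric] by simp
  then have "(cmod (cinner x y))\<^sup>2 \<le> (norm x * norm y)\<^sup>2"
    using False by (simp add: pos_divide_le_eq power_mult_distrib)
  then show ?thesis by (rule power2_le_imp_le) simp
qed (simp add: cinner_simps)

text \<open>
  The point of \<open>K\<close> nearest to \<open>x\<close>: by the parallelogram law, applied to the midpoint of two members,
  a minimizing sequence is Cauchy.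
\<close>

lemma orthogonal_decomposition:
  fixes K :: "'h::complex_hilbert_space set"
  assumes sub: "complex_vector.subspace K" and cl: "closed K"
  shows "\<exists>y\<in>K. \<forall>k\<in>K. cinner (x - y) k = 0"
proof -
  have K0: "0 \<in> K" using sub by (rule complex_vector.subspace_0)
  define d where "d = (INF k\<in>K. (norm (x - k))\<^sup>2)"
  have d_le: "d \<le> (norm (x - k))\<^sup>2" if "k \<in> K" for k
    unfolding d_def by (rule cINF_lower[OF _ that]) (rule bdd_belowI2[of _ 0], simp)
  have "\<exists>k\<in>K. (norm (x - k))\<^sup>2 < d + 1 / real (Suc m)" for m
    using cInf_lessD[of "(\<lambda>k. (norm (x - k))\<^sup>2) ` K" "d + 1 / real (Suc m)"] K0
    by (auto simp: d_def)
  then obtain y where yK: "\<And>m. y m \<in> K"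
    and y: "\<And>m. (norm (x - y m))\<^sup>2 < d + 1 / real (Suc m)" by metis
  have close: "(norm (y i - y j))\<^sup>2 \<le> 2 / real (Suc i) + 2 / real (Suc j)" for i j
  proof -
    let ?m = "(1/2) *\<^sub>C (y i + y j)"
    have mK: "?m \<in> K" using yK sub by (simp add: complex_vector.subspace_add complex_vector.subspace_scale)
    have "(x - y i) + (x - y j) = 2 *\<^sub>C (x - ?m)"
      by (simp add: complex_vector.scale_right_diff_distrib scaleC_scaleC scaleC_one)
        (metis add_diff_add one_add_one scaleC_add_left scaleC_one)
    then have "4 * (norm (x - ?m))\<^sup>2 = (norm ((x - y i) + (x - y j)))\<^sup>2"
      by (simp add: norm_scaleC power_mult_distrib)
    moreover have "(norm (y i - y j))\<^sup>2 = (norm ((x - y j) - (x - y i)))\<^sup>2" by (simp add: algebra_simps)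
    ultimately have "(norm (y i - y j))\<^sup>2 + 4 * (norm (x - ?m))\<^sup>2 = 2 * (norm (x - y i))\<^sup>2 + 2 * (norm (x - y j))\<^sup>2"
      using parallelogram[of "x - y j" "x - y i"] by (simp add: add.commute)
    moreover have "d \<le> (norm (x - ?m))\<^sup>2" by (rule d_le[OF mK])
    ultimately show ?thesis using y[of i] y[of j] by simp
  qed
  have "Cauchy y"
  proof (rule CauchyI)
    fix e :: real assume e: "e > 0"
    obtain M where M: "4 / real (Suc M) < e\<^sup>2"
    proof -
      obtain M where "inverse (real (Suc M)) < e\<^sup>2 / 4"
        using reals_Archimedean[of "e\<^sup>2 / 4"] e by auto
      then show ?thesis by (intro that[of M]) (simp add: inverse_eq_divide)
    qed
    have "norm (y i - y j) < e" if "i \<ge> M" "j \<ge> M" for i j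
    proof -
      have "2 / real (Suc i) \<le> 2 / real (Suc M)" "2 / real (Suc j) \<le> 2 / real (Suc M)"
        using that by (auto intro!: divide_left_mono)
      then have "(norm (y i - y j))\<^sup>2 < e\<^sup>2" using close[of i j] M by simp
      then show ?thesis using e by (simp add: power_less_imp_less_base)
    qed
    then show "\<exists>M. \<forall>m\<ge>M. \<forall>n\<ge>M. norm (y m - y n) < e" by blast
  qed
  then obtain l where l: "y \<longlonglongrightarrow> l" using Cauchy_convergent convergent_def by blast
  have lK: "l \<in> K" using closed_sequentially[OF cl] yK l by blast
  have "(\<lambda>m. (norm (x - y m))\<^sup>2) \<longlonglongrightarrow> (norm (x - l))\<^sup>2" by (intro tendsto_intros l)
  moreover have "(\<lambda>m. d + 1 / real (Suc m)) \<longlonglongrightarrow> d + 0"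
    using LIMSEQ_inverse_real_of_nat by (intro tendsto_intros) (simp add: inverse_eq_divide)
  ultimately have l_le: "(norm (x - l))\<^sup>2 \<le> d"
    using y by (intro LIMSEQ_le) (auto intro: less_imp_le)
  have min: "(norm (x - l))\<^sup>2 \<le> (norm (x - k))\<^sup>2" if "k \<in> K" for k
    by (rule order_trans[OF l_le d_le[OF that]])
  have "cinner (x - l) k = 0" if k: "k \<in> K" for k
  proof (cases "k = 0")
    case False
    let ?c = "cinner (x - l) k / (norm k)\<^sup>2"
    have "l + ?c *\<^sub>C k \<in> K" using lK k sub by (simp add: complex_vector.subspace_add complex_vector.subspace_scale)
    from min[OF this] have "(norm (x - l))\<^sup>2 \<le> (norm ((x - l) - ?c *\<^sub>C k))\<^sup>2" by (simp add: algebra_simps)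
    then have "(cmod (cinner (x - l) k))\<^sup>2 / (norm k)\<^sup>2 \<le> 0"
      unfolding norm_sq_minus_component[OF False] by simp
    then show ?thesis using False by (simp add: divide_le_0_iff)
  qed (simp add: cinner_simps)
  then show ?thesis using lK by blast
qed

lemma bop_eqI: "(\<And>x. bop_apply S x = bop_apply T x) \<Longrightarrow> S = T"
  by (simp add: bop_apply_inject[symmetric] fun_eq_iff)

lemma bop_apply_simps [simp]:
  "bop_apply 0 x = 0" "bop_apply 1 x = x" "bop_apply (S + T) x = bop_apply S x + bop_apply T x"
  "bop_apply (S - T) x = bop_apply S x - bop_apply T x" "bop_apply (- T) x = - bop_apply T x"
  "bop_apply (S * T) x = bop_apply S (bop_apply T x)"
  "bop_apply (c *\<^sub>C T) x = c *\<^sub>C bop_apply T x"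
  by (transfer; simp)+

lemma bop_linear:
  "bop_apply T (x + y) = bop_apply T x + bop_apply T y"
  "bop_apply T (x - y) = bop_apply T x - bop_apply T y"
  "bop_apply T (c *\<^sub>C x) = c *\<^sub>C bop_apply T x"
  "bop_apply T 0 = 0" "bop_apply T (- x) = - bop_apply T x"
  by (transfer; auto dest!: bounded_linear.linear simp: linear_add linear_diff linear_0 linear_neg)+

lemma bop_bounded_linear: "bounded_linear (bop_apply T)"
  by transfer auto

lemma bop_scale_mult_left: "(c *\<^sub>C S) * T = c *\<^sub>C (S * T)"
  and bop_scale_mult_right: "S * (c *\<^sub>C T) = c *\<^sub>C (S * T)"
  for S T :: "'h::complex_hilbert_space bop"
  by (rule bop_eqI, simp add: bop_linear)+

lemmas bop_scale_mult = bop_scale_mult_left bop_scale_mult_right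

lemma Bop_exists:
  fixes f :: "'h::complex_hilbert_space \<Rightarrow> 'h"
  assumes "\<And>x y. f (x + y) = f x + f y" "\<And>c x. f (c *\<^sub>C x) = c *\<^sub>C f x"
    "\<And>x. norm (f x) \<le> norm x * B"
  shows "\<exists>T. \<forall>x. bop_apply T x = f x"
proof -
  have "bounded_linear f"
    by (rule bounded_linear_intro[of f B]) (use assms in \<open>auto simp: scaleR_scaleC\<close>)
  then have "bop_apply (Bop f) = f" using assms(2) by (simp add: Bop_inverse)
  then show ?thesis by metis
qed

definition is_proj :: "'h::complex_hilbert_space set \<Rightarrow> 'h bop \<Rightarrow> bool" where
  "is_proj K P \<longleftrightarrow> (\<forall>x. bop_apply P x \<in> K \<and> (\<forall>k\<in>K. cinner (x - bop_apply P x) k = 0))"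

lemma proj_unique:
  assumes "complex_vector.subspace K" "y \<in> K" "z \<in> K"
    "\<forall>k\<in>K. cinner (x - y) k = 0" "\<forall>k\<in>K. cinner (x - z) k = 0"
  shows "y = (z::'h::complex_hilbert_space)"
proof -
  have "y - z \<in> K" using assms complex_vector.subspace_diff by blast
  then have "cinner ((x - z) - (x - y)) (y - z) = 0"
    unfolding cinner_simps(3)[of "x - z" "x - y"] using assms(4,5) by simp
  then have "cinner (y - z) (y - z) = 0" by simp
  then show ?thesis by (simp add: cinner_0_iff)
qed

lemma projection_exists:
  assumes sub: "complex_vector.subspace K" and cl: "closed K"
  shows "\<exists>P. is_proj K P"
proof -
  obtain f where f: "\<And>x. f x \<in> K" "\<And>x k. k \<in> K \<Longrightarrow> cinner (x - f x) k = 0"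
    using orthogonal_decomposition[OF assms] by metis
  have "\<exists>T. \<forall>x. bop_apply T x = f x"
  proof (rule Bop_exists)
    show "f (x + y) = f x + f y" for x y
    proof (rule proj_unique[OF sub f(1)])
      show "f x + f y \<in> K" using f sub complex_vector.subspace_add by blast
      have "x + y - (f x + f y) = (x - f x) + (y - f y)" by simp
      then show "\<forall>k\<in>K. cinner (x + y - (f x + f y)) k = 0"
        using f(2) by (simp only: cinner_simps(1)) simp
    qed (use f in auto)
    show "f (c *\<^sub>C x) = c *\<^sub>C f x" for c x
    proof (rule proj_unique[OF sub f(1)])
      show "c *\<^sub>C f x \<in> K" using f sub complex_vector.subspace_scale by blast
      show "\<forall>k\<in>K. cinner (c *\<^sub>C x - c *\<^sub>C f x) k = 0"
        using f(2) by (simp only: complex_vector.scale_right_diff_distrib[symmetric] cinner_simps(5)) simp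
    qed (use f in auto)
    show "norm (f x) \<le> norm x * 1" for x
    proof -
      have "(norm x)\<^sup>2 = (norm ((x - f x) + f x))\<^sup>2" by simp
      also have "\<dots> = (norm (x - f x))\<^sup>2 + (norm (f x))\<^sup>2"
        unfolding norm_sq_add[of "x - f x"] using f by simp
      finally have "(norm (f x))\<^sup>2 \<le> (norm x)\<^sup>2" by simp
      then show ?thesis by simp
    qed
  qed
  then show ?thesis using f unfolding is_proj_def by metis
qed

lemma proj_in: "is_proj K P \<Longrightarrow> bop_apply P x \<in> K"
  and proj_orth: "is_proj K P \<Longrightarrow> k \<in> K \<Longrightarrow> cinner (x - bop_apply P x) k = 0"
  by (simp_all add: is_proj_def)

lemma proj_fixes:
  assumes "complex_vector.subspace K" "is_proj K P" "x \<in> K" shows "bop_apply P x = x"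
  by (rule proj_unique[OF assms(1) proj_in[OF assms(2)] assms(3), of x])
    (use proj_orth[OF assms(2)] in blast, simp add: cinner_simps)

lemma proj_idem:
  assumes "complex_vector.subspace K" "is_proj K P" shows "P * P = P"
  by (rule bop_eqI) (simp add: proj_fixes[OF assms proj_in[OF assms(2)]])

lemma proj_selfadj:
  assumes "complex_vector.subspace K" "is_proj K P"
  shows "cinner (bop_apply P x) y = cinner x (bop_apply P y)"
proof -
  have 1: "cinner (x - bop_apply P x) (bop_apply P y) = 0" "cinner (y - bop_apply P y) (bop_apply P x) = 0"
    by (rule proj_orth[OF assms(2) proj_in[OF assms(2)]])+
  have "cinner (bop_apply P x) (y - bop_apply P y) = 0"
    using 1(2) by (subst cinner_commute) simp
  then show ?thesis using 1(1) by (simp add: cinner_simps)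
qed

text \<open>
  The operator \<open>S\<close> is an adjoint of \<open>T\<close>, and invariance of \<open>K\<close> under it makes the orthogonal
  complement of \<open>K\<close> invariant under \<open>T\<close>.
\<close>

lemma proj_commute:
  assumes sub: "complex_vector.subspace K" and P: "is_proj K P"
    and T: "\<And>x. x \<in> K \<Longrightarrow> bop_apply T x \<in> K" and S: "\<And>x. x \<in> K \<Longrightarrow> bop_apply S x \<in> K"
    and adj: "\<And>x y. cinner (bop_apply T x) y = cinner x (bop_apply S y)"
  shows "P * T = T * P"
proof (rule bop_eqI)
  fix x
  have "bop_apply P (bop_apply T x) = bop_apply T (bop_apply P x)"
  proof (rule proj_unique[OF sub])
    show "\<forall>k\<in>K. cinner (bop_apply T x - bop_apply T (bop_apply P x)) k = 0"
      unfolding bop_linear(2)[symmetric] adj using proj_orth[OF P] S by blast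
  qed (use proj_in[OF P] proj_orth[OF P] T in auto)
  then show "bop_apply (P * T) x = bop_apply (T * P) x" by simp
qed

text \<open>
  A functional is determined up to scaling by its kernel, so the representing vector is a multiple
  of any non-zero vector orthogonal to the kernel.
\<close>

lemma riesz:
  fixes f :: "'h::complex_hilbert_space \<Rightarrow> complex"
  assumes add: "\<And>x y. f (x + y) = f x + f y" and scale: "\<And>c x. f (c *\<^sub>C x) = c * f x"
    and bdd: "\<And>x. cmod (f x) \<le> norm x * B"
  shows "\<exists>v. \<forall>y. f y = cinner y v"
proof (cases "\<forall>x. f x = 0")
  case False
  then obtain u where u: "f u \<noteq> 0" by blast
  let ?K = "{x. f x = 0}"
  have bl: "bounded_linear f"
    by (rule bounded_linear_intro[of f B]) (use assms in \<open>auto simp: scaleR_scaleC scaleR_conv_of_real\<close>)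
  have f0: "f 0 = 0" using add[of 0 0] by simp
  have sub: "complex_vector.subspace ?K"
    by (simp add: complex_vector.subspace_def add scale f0)
  have "closed ?K"
    by (rule closed_Collect_eq) (auto intro: bounded_linear.continuous_on[OF bl] continuous_on_const)
  then obtain w0 where w0: "f w0 = 0" "\<And>k. f k = 0 \<Longrightarrow> cinner (u - w0) k = 0"
    using orthogonal_decomposition[OF sub, of u] by auto
  define w where "w = u - w0"
  have fw: "f w = f u" using add[of w w0] w0(1) by (simp add: w_def)
  then have w: "w \<noteq> 0" "f w \<noteq> 0" using u f0 by auto
  have "f y = cinner y (cnj (f w / cinner w w) *\<^sub>C w)" for y
  proof -
    have "f (y - (f y / f w) *\<^sub>C w) = 0"
      using add[of "y - (f y / f w) *\<^sub>C w" "(f y / f w) *\<^sub>C w"] w by (simp add: scale)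
    then have "cinner w (y - (f y / f w) *\<^sub>C w) = 0" using w0(2) w_def by blast
    then have "cinner (y - (f y / f w) *\<^sub>C w) w = 0" by (subst cinner_commute) simp
    then have "cinner y w = (f y / f w) * cinner w w" by (simp add: cinner_simps)
    then show ?thesis using w cinner_0_iff[of w] by (simp add: cinner_simps)
  qed
  then show ?thesis by blast
qed (auto intro: exI[of _ 0] simp: cinner_simps)

lemma adj_exists:
  fixes T :: "'h::complex_hilbert_space bop"
  shows "\<exists>S. \<forall>x y. cinner (bop_apply S x) y = cinner x (bop_apply T y)"
proof -
  obtain B where B: "\<And>x. norm (bop_apply T x) \<le> norm x * B" "B > 0"
    using bounded_linear.pos_bounded[OF bop_bounded_linear] by blast
  have "\<exists>v. \<forall>y. cinner (bop_apply T y) x = cinner y v" for x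
  proof (rule riesz)
    show "cmod (cinner (bop_apply T y) x) \<le> norm y * (B * norm x)" for y
      using order_trans[OF cinner_Cauchy_Schwarz mult_right_mono[OF B(1) norm_ge_zero]]
      by (simp add: mult.assoc)
  qed (simp_all add: bop_linear cinner_simps)
  then obtain s where s: "\<And>x y. cinner (bop_apply T y) x = cinner y (s x)" by metis
  have s': "cinner (s x) y = cinner x (bop_apply T y)" for x y
    by (subst cinner_commute, subst s[symmetric], rule cinner_commute[symmetric])
  have "\<exists>S. \<forall>x. bop_apply S x = s x"
  proof (rule Bop_exists)
    show "s (x + y) = s x + s y" "s (c *\<^sub>C x) = c *\<^sub>C s x" for x y c
      by (rule cinner_ext; simp add: s' cinner_simps)+
    show "norm (s x) \<le> norm x * B" for x
    proof (cases "s x = 0")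
      case False
      have "(norm (s x))\<^sup>2 = cmod (cinner (s x) (s x))" by (simp add: cinner_self norm_power)
      also have "\<dots> \<le> norm x * norm (bop_apply T (s x))" unfolding s' by (rule cinner_Cauchy_Schwarz)
      also have "\<dots> \<le> norm x * (norm (s x) * B)" by (rule mult_left_mono[OF B(1)]) simp
      finally have "norm (s x) * norm (s x) \<le> norm (s x) * (norm x * B)"
        by (simp add: power2_eq_square mult_ac)
      then show ?thesis using False by simp
    qed (use B in simp)
  qed
  then show ?thesis using s' by metis
qed

lemma adj_unique:
  assumes "\<And>x y. cinner (bop_apply S x) y = cinner x (bop_apply T y)"
  shows "adj T = S"
  unfolding adj_def
proof (rule the_equality)
  fix R assume "\<forall>x y. cinner (bop_apply R x) y = cinner x (bop_apply T y)"
  then show "R = S" by (intro bop_eqI cinner_ext) (simp add: assms)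
qed (simp add: assms)

lemma adj: "cinner (bop_apply (adj T) x) y = cinner x (bop_apply T y)"
proof -
  obtain S where S: "\<And>x y. cinner (bop_apply S x) y = cinner x (bop_apply T y)"
    using adj_exists[of T] by blast
  then have "adj T = S" by (rule adj_unique)
  then show ?thesis using S by simp
qed

lemma adj': "cinner (bop_apply T x) y = cinner x (bop_apply (adj T) y)"
  by (subst cinner_commute, subst adj[symmetric], rule cinner_commute[symmetric])

lemma adj_adj: "adj (adj T) = T"
  by (rule adj_unique) (rule adj')

lemma adj_mult: "adj (S * T) = adj T * adj S"
  by (rule adj_unique) (simp add: adj)

lemma adj_add: "adj (S + T) = adj S + adj T"
  by (rule adj_unique) (simp add: adj cinner_simps)

lemma adj_diff: "adj (S - T) = adj S - adj T"
  by (rule adj_unique) (simp add: adj cinner_simps)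

lemma adj_scale: "adj (c *\<^sub>C T) = cnj c *\<^sub>C adj T"
  by (rule adj_unique) (simp add: adj cinner_simps)

section \<open>The absolute value of a self-adjoint operator\<close>

text \<open>
  The equation \<open>Y = (X + Y\<^sup>2) / 2\<close> says \<open>(1 - Y)\<^sup>2 = 1 - X\<close>.  Solving it by iteration from \<open>0\<close> produces
  polynomials in \<open>X\<close> with non-negative coefficients, so for \<open>norm X \<le> 1\<close> the scalar iteration with
  \<open>X = 1\<close> dominates the operator iteration together with all its increments.  The scalar sequence
  increases and stays below \<open>1\<close>, and the operator sequence is therefore Cauchy.
\<close>

primrec sqrt_bound :: "nat \<Rightarrow> real" where
  "sqrt_bound 0 = 0"
| "sqrt_bound (Suc m) = (1 + (sqrt_bound m)\<^sup>2) / 2"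

primrec sqrt_iter :: "('a::real_normed_vector \<Rightarrow>\<^sub>L 'a) \<Rightarrow> nat \<Rightarrow> 'a \<Rightarrow>\<^sub>L 'a" where
  "sqrt_iter X 0 = 0"
| "sqrt_iter X (Suc m) = (1/2) *\<^sub>R (X + (sqrt_iter X m o\<^sub>L sqrt_iter X m))"

lemma sqrt_bound_range: "0 \<le> sqrt_bound m" "sqrt_bound m \<le> 1"
  by (induction m) (auto simp: power_le_one)

lemma sqrt_bound_mono: "sqrt_bound m \<le> sqrt_bound (Suc m)"
  using zero_le_power2[of "1 - sqrt_bound m"] by (simp add: power2_eq_square algebra_simps)

lemma sqrt_bound_convergent: "convergent sqrt_bound"
proof -
  from sqrt_bound_mono have "incseq sqrt_bound" by (rule incseq_SucI)
  from incseq_convergent[OF this, of 1] sqrt_bound_range show ?thesis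
    by (metis convergent_def)
qed

interpretation blinfun_comp: bounded_bilinear "(o\<^sub>L)"
  by (rule bounded_bilinear_blinfun_compose)

lemma norm_sqrt_iter:
  assumes "norm X \<le> 1" shows "norm (sqrt_iter X m) \<le> sqrt_bound m"
proof (induction m)
  case (Suc m)
  let ?Y = "sqrt_iter X m"
  have "norm (?Y o\<^sub>L ?Y) \<le> norm ?Y * norm ?Y" by (rule norm_blinfun_compose)
  also have "\<dots> \<le> (sqrt_bound m)\<^sup>2"
    unfolding power2_eq_square by (rule mult_mono) (use Suc sqrt_bound_range in auto)
  finally have "norm (X + (?Y o\<^sub>L ?Y)) \<le> 1 + (sqrt_bound m)\<^sup>2"
    using assms norm_triangle_ineq[of X "?Y o\<^sub>L ?Y"] by linarith
  then show ?case by simp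
qed simp

lemma norm_sqrt_iter_step:
  assumes "norm X \<le> 1"
  shows "norm (sqrt_iter X (Suc m) - sqrt_iter X m) \<le> sqrt_bound (Suc m) - sqrt_bound m"
proof (induction m)
  case (Suc m)
  let ?Y = "sqrt_iter X m" and ?Z = "sqrt_iter X (Suc m)"
  let ?y = "sqrt_bound m" and ?z = "sqrt_bound (Suc m)"
  have "(?Z o\<^sub>L ?Z) - (?Y o\<^sub>L ?Y) = (?Z o\<^sub>L (?Z - ?Y)) + ((?Z - ?Y) o\<^sub>L ?Y)"
    by (simp add: blinfun_comp.diff_left blinfun_comp.diff_right del: sqrt_iter.simps)
  also have "norm \<dots> \<le> norm ?Z * norm (?Z - ?Y) + norm (?Z - ?Y) * norm ?Y"
    by (rule order_trans[OF norm_triangle_ineq add_mono]) (rule norm_blinfun_compose)+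
  also have "\<dots> \<le> ?z * (?z - ?y) + (?z - ?y) * ?y"
    using norm_sqrt_iter[OF assms, of m] norm_sqrt_iter[OF assms, of "Suc m"] Suc sqrt_bound_range sqrt_bound_mono
    by (intro add_mono mult_mono) (auto simp del: sqrt_iter.simps sqrt_bound.simps intro: order_trans[OF norm_ge_zero])
  also have "\<dots> = ?z\<^sup>2 - ?y\<^sup>2" by (simp add: power2_eq_square algebra_simps del: sqrt_bound.simps)
  finally have "norm ((1/2) *\<^sub>R ((?Z o\<^sub>L ?Z) - (?Y o\<^sub>L ?Y))) \<le> (?z\<^sup>2 - ?y\<^sup>2) / 2"
    by (simp del: sqrt_iter.simps sqrt_bound.simps)
  moreover have "sqrt_iter X (Suc (Suc m)) - ?Z = (1/2) *\<^sub>R ((?Z o\<^sub>L ?Z) - (?Y o\<^sub>L ?Y))"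
    unfolding sqrt_iter.simps(2)[of X "Suc m"] sqrt_iter.simps(2)[of X m]
    by (simp only: scaleR_diff_right[symmetric] add_diff_cancel_left)
  moreover have "sqrt_bound (Suc (Suc m)) - ?z = (?z\<^sup>2 - ?y\<^sup>2) / 2"
    unfolding sqrt_bound.simps(2)[of "Suc m"] sqrt_bound.simps(2)[of m] by (simp add: field_simps)
  ultimately show ?case by simp
qed (use assms in simp)

lemma norm_sqrt_iter_diff:
  assumes "norm X \<le> 1"
  shows "norm (sqrt_iter X (m + k) - sqrt_iter X m) \<le> sqrt_bound (m + k) - sqrt_bound m"
proof (induction k)
  case (Suc k)
  have "norm (sqrt_iter X (m + Suc k) - sqrt_iter X m)
    \<le> norm (sqrt_iter X (Suc (m + k)) - sqrt_iter X (m + k)) + norm (sqrt_iter X (m + k) - sqrt_iter X m)"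
    using dist_triangle[of "sqrt_iter X (Suc (m + k))" "sqrt_iter X m" "sqrt_iter X (m + k)"]
    by (simp only: dist_norm add_Suc_right)
  then show ?case using Suc norm_sqrt_iter_step[OF assms, of "m + k"]
    unfolding add_Suc_right by linarith
qed simp

lemma sqrt_fixpoint:
  fixes X :: "'a::banach \<Rightarrow>\<^sub>L 'a"
  assumes X: "norm X \<le> 1"
  obtains Y where "norm Y \<le> 1" "Y + Y = X + (Y o\<^sub>L Y)"
    "\<And>W. W o\<^sub>L X = X o\<^sub>L W \<Longrightarrow> W o\<^sub>L Y = Y o\<^sub>L W"
proof -
  let ?Y = "sqrt_iter X"
  have "Cauchy ?Y"
  proof (rule CauchyI')
    fix e :: real assume "e > 0"
    then obtain M where M: "\<And>m n. m \<ge> M \<Longrightarrow> n \<ge> M \<Longrightarrow> norm (sqrt_bound m - sqrt_bound n) < e"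
      using CauchyD[OF convergent_Cauchy[OF sqrt_bound_convergent]] by blast
    have "dist (?Y m) (?Y n) < e" if "m \<ge> M" "n > m" for m n
      using norm_sqrt_iter_diff[OF X, of m "n - m"] M[of n m] that
      by (simp add: dist_norm norm_minus_commute)
    then show "\<exists>M. \<forall>m\<ge>M. \<forall>n>m. dist (?Y m) (?Y n) < e" by blast
  qed
  then obtain Y where Y: "?Y \<longlonglongrightarrow> Y" using Cauchy_convergent convergent_def by blast
  have "norm Y \<le> 1"
    using norm_sqrt_iter[OF X] sqrt_bound_range(2)
    by (intro LIMSEQ_le_const2[OF tendsto_norm[OF Y]]) (blast intro: order_trans)
  moreover have "Y = (1/2) *\<^sub>R (X + (Y o\<^sub>L Y))"
  proof (rule LIMSEQ_unique[OF LIMSEQ_Suc[OF Y]])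
    show "(\<lambda>m. ?Y (Suc m)) \<longlonglongrightarrow> (1/2) *\<^sub>R (X + (Y o\<^sub>L Y))"
      unfolding sqrt_iter.simps by (intro tendsto_intros blinfun_comp.tendsto Y)
  qed
  then have "2 *\<^sub>R Y = 2 *\<^sub>R ((1/2) *\<^sub>R (X + (Y o\<^sub>L Y)))" by (rule arg_cong)
  then have "Y + Y = X + (Y o\<^sub>L Y)" by (simp add: scaleR_2)
  moreover have "W o\<^sub>L Y = Y o\<^sub>L W" if W: "W o\<^sub>L X = X o\<^sub>L W" for W
  proof -
    have "W o\<^sub>L ?Y m = ?Y m o\<^sub>L W" for m
    proof (induction m)
      case (Suc m)
      have "blinfun_apply W (blinfun_apply (?Y m) z) = blinfun_apply (?Y m) (blinfun_apply W z)" for z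
        using arg_cong[OF Suc, of "\<lambda>B. blinfun_apply B z"] by simp
      then have "W o\<^sub>L (?Y m o\<^sub>L ?Y m) = (?Y m o\<^sub>L ?Y m) o\<^sub>L W"
        by (intro blinfun_eqI) simp
      then show ?case
        by (simp add: blinfun_comp.scaleR_left blinfun_comp.scaleR_right blinfun_comp.add_left blinfun_comp.add_right W)
    qed simp
    then show ?thesis
      using LIMSEQ_unique blinfun_comp.tendsto[OF tendsto_const Y, of W] blinfun_comp.tendsto[OF Y tendsto_const, of W]
      by simp
  qed
  ultimately show thesis using that by blast
qed

definition selfadj :: "'h::complex_hilbert_space bop \<Rightarrow> bool" where
  "selfadj T \<longleftrightarrow> adj T = T"

lemma selfadjD: "selfadj T \<Longrightarrow> cinner (bop_apply T x) y = cinner x (bop_apply T y)"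
  using adj[of T x y] by (simp add: selfadj_def)

lemma selfadjI: "(\<And>x y. cinner (bop_apply T x) y = cinner x (bop_apply T y)) \<Longrightarrow> selfadj T"
  unfolding selfadj_def by (rule adj_unique)

text \<open>
  The square root of \<open>T\<^sup>2 = 1 - X\<close>, for the contraction \<open>X = 1 - T\<^sup>2\<close>, is \<open>1 - Y\<close> with \<open>Y\<close> the solution of
  \<open>Y = (X + Y\<^sup>2) / 2\<close>.  It is positive because \<open>norm Y \<le> 1\<close>.  The iteration takes place among bounded
  real-linear operators; complex linearity of the limit is one instance of the fact that \<open>Y\<close>
  commutes with everything that commutes with \<open>X\<close>.
\<close>

lemma absolute_value:
  fixes T :: "'h::complex_hilbert_space bop"
  assumes sa: "selfadj T" and contr: "\<And>x. norm (bop_apply T x) \<le> norm x"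
  obtains S where "S * S = T * T" "\<And>x. 0 \<le> Re (cinner (bop_apply S x) x)"
    "\<And>W. W * T = T * W \<Longrightarrow> W * S = S * W"
proof -
  let ?b = "\<lambda>R::'h bop. Blinfun (bop_apply R)"
  have b: "blinfun_apply (?b R) x = bop_apply R x" for R x
    by (simp add: bounded_linear_Blinfun_apply bop_bounded_linear)
  define X where "X = ?b (1 - T * T)"
  have X: "blinfun_apply X x = x - bop_apply T (bop_apply T x)" for x
    by (simp add: X_def b)
  have "norm X \<le> 1"
  proof (rule norm_blinfun_bound)
    fix x
    let ?t = "bop_apply T"
    have "(norm (blinfun_apply X x))\<^sup>2 = (norm x)\<^sup>2 + (norm (?t (?t x)))\<^sup>2 - 2 * (norm (?t x))\<^sup>2"
      by (simp add: X norm_sq_diff norm_sq[of "?t x"] selfadjD[OF sa, of x])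
    also have "\<dots> \<le> (norm x)\<^sup>2"
      using power_mono[OF contr[of "?t x"] norm_ge_zero, of 2] zero_le_power2[of "norm (?t x)"] by linarith
    finally show "norm (blinfun_apply X x) \<le> 1 * norm x"
      unfolding mult_1 by (rule power2_le_imp_le) simp
  qed simp
  then obtain Y where Y: "norm Y \<le> 1" "Y + Y = X + (Y o\<^sub>L Y)"
    "\<And>W. W o\<^sub>L X = X o\<^sub>L W \<Longrightarrow> W o\<^sub>L Y = Y o\<^sub>L W" by (rule sqrt_fixpoint) blast
  define y where "y = blinfun_apply Y"
  have sc: "y (c *\<^sub>C x) = c *\<^sub>C y x" for c x
  proof -
    have e: "blinfun_apply (Blinfun (\<lambda>x::'h. c *\<^sub>C x)) x = c *\<^sub>C x" for x
      by (simp add: bounded_linear_Blinfun_apply bounded_linear_scaleC)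
    have "Blinfun (\<lambda>x::'h. c *\<^sub>C x) o\<^sub>L Y = Y o\<^sub>L Blinfun (\<lambda>x::'h. c *\<^sub>C x)"
      by (rule Y(3)) (rule blinfun_eqI, simp add: e X bop_linear complex_vector.scale_right_diff_distrib)
    then have "blinfun_apply (Blinfun (\<lambda>x::'h. c *\<^sub>C x) o\<^sub>L Y) x = blinfun_apply (Y o\<^sub>L Blinfun (\<lambda>x::'h. c *\<^sub>C x)) x"
      by simp
    then show ?thesis by (simp add: e y_def)
  qed
  have ny: "norm (y x) \<le> norm x" for x
    using norm_blinfun[of Y x] mult_right_mono[OF Y(1) norm_ge_zero[of x]] by (simp add: y_def)
  have "\<exists>R. \<forall>x. bop_apply R x = y x"
    by (rule Bop_exists[of y 1]) (simp_all add: y_def blinfun.add_right sc[unfolded y_def] ny[unfolded y_def])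
  then obtain R where R: "\<And>x. bop_apply R x = y x" by blast
  show thesis
  proof (rule that[of "1 - R"])
    have yy: "y x + y x = x - bop_apply T (bop_apply T x) + y (y x)" for x
      using arg_cong[OF Y(2), of "\<lambda>B. blinfun_apply B x"] by (simp add: blinfun.add_left X y_def)
    have "x - y x - (y x - y (y x)) = bop_apply T (bop_apply T x)" for x
      using yy[of x] by (simp add: algebra_simps)
    then show "(1 - R) * (1 - R) = T * T"
      by (intro bop_eqI) (simp add: R blinfun.diff_right y_def)
    show "0 \<le> Re (cinner (bop_apply (1 - R) x) x)" for x
    proof -
      have "Re (cinner (y x) x) \<le> norm (y x) * norm x"
        using complex_Re_le_cmod order_trans cinner_Cauchy_Schwarz by blast
      also have "\<dots> \<le> (norm x)\<^sup>2"
        unfolding power2_eq_square by (rule mult_right_mono[OF ny]) simp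
      finally show ?thesis by (simp add: R cinner_simps norm_sq)
    qed
    show "W * (1 - R) = (1 - R) * W" if "W * T = T * W" for W
    proof -
      have WT: "bop_apply W (bop_apply T x) = bop_apply T (bop_apply W x)" for x
        using arg_cong[OF that, of "\<lambda>B. bop_apply B x"] by simp
      have "?b W o\<^sub>L Y = Y o\<^sub>L ?b W"
        by (rule Y(3)) (rule blinfun_eqI, simp add: b X bop_linear WT)
      then have "blinfun_apply (?b W o\<^sub>L Y) x = blinfun_apply (Y o\<^sub>L ?b W) x" for x by simp
      then have "bop_apply W (y x) = y (bop_apply W x)" for x by (simp add: b y_def)
      then show ?thesis by (intro bop_eqI) (simp add: R bop_linear)
    qed
  qed
qed

lemma quadratic_form_0:
  fixes R :: "'h::complex_hilbert_space bop"
  assumes "\<And>x. cinner (bop_apply R x) x = 0" shows "R = 0"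
proof (rule bop_eqI, rule cinner_ext)
  fix x y
  have "cinner (bop_apply R x) y + cinner (bop_apply R y) x = 0"
    using assms[of "x + y"] assms[of x] assms[of y] by (simp add: bop_linear cinner_simps add.commute)
  moreover have "cinner (bop_apply R x) y - cinner (bop_apply R y) x = 0"
    using assms[of "x + \<i> *\<^sub>C y"] assms[of x] assms[of y]
    by (simp add: bop_linear cinner_simps algebra_simps)
  ultimately show "cinner (bop_apply R x) y = cinner (bop_apply 0 x) y"
    by (simp add: cinner_simps)
qed

lemma selfadj_closed:
  "selfadj S \<Longrightarrow> selfadj T \<Longrightarrow> selfadj (S + T)"
  "selfadj S \<Longrightarrow> selfadj T \<Longrightarrow> selfadj (S - T)"
  "selfadj T \<Longrightarrow> selfadj (complex_of_real r *\<^sub>C T)"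
  "selfadj 1" 
  unfolding selfadj_def
     apply (simp_all add: adj_add adj_diff adj_scale)
  by (rule adj_unique) simp

text \<open>
  On the range of \<open>e\<close> the quadratic form of \<open>T\<close> is not a constant multiple of the squared norm, since
  otherwise polarization would make \<open>T\<close> a multiple of \<open>e\<close>.  So it has two different values on unit vectors, and \<open>r\<close> is their mean.
\<close>

lemma indefinite_shift:
  fixes T e :: "'h::complex_hilbert_space bop"
  assumes sa: "selfadj T" "selfadj e" and e: "e * e = e" "e * T = T" "T * e = T" "e \<noteq> 0"
    and nonscalar: "\<And>c. T \<noteq> c *\<^sub>C e"
  obtains r x y where "bop_apply e x = x" "bop_apply e y = y"
    "Re (cinner (bop_apply (T - complex_of_real r *\<^sub>C e) x) x) < 0"
    "0 < Re (cinner (bop_apply (T - complex_of_real r *\<^sub>C e) y) y)"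
proof -
  let ?a = "\<lambda>x. Re (cinner (bop_apply T x) x)"
  have ee: "bop_apply e (bop_apply e x) = bop_apply e x" for x
    using arg_cong[OF e(1), of "\<lambda>B. bop_apply B x"] by simp
  obtain h where "bop_apply e h \<noteq> 0" using e(4) bop_eqI[of e 0] by auto
  then obtain x where x: "bop_apply e x = x" "x \<noteq> 0" using ee by blast
  define r0 where "r0 = ?a x / (norm x)\<^sup>2"
  let ?R = "T - complex_of_real r0 *\<^sub>C e"
  have saR: "selfadj ?R" by (intro selfadj_closed sa)
  have eR: "e * ?R * e = ?R"
    using e by (simp add: algebra_simps bop_scale_mult)
  have "?R \<noteq> 0" using nonscalar[of "complex_of_real r0"] by simp
  then obtain y0 where y0: "cinner (bop_apply ?R y0) y0 \<noteq> 0" using quadratic_form_0 by blast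
  define y where "y = bop_apply e y0"
  have y: "bop_apply e y = y" by (simp add: y_def ee)
  have "cinner (bop_apply ?R y) y = cinner (bop_apply (e * ?R * e) y0) y0"
    by (simp add: y_def selfadjD[OF sa(2)] del: bop_apply_simps(4,7))
  then have y1: "cinner (bop_apply ?R y) y \<noteq> 0" using y0 unfolding eR by simp
  have "cinner (bop_apply ?R y) y = cnj (cinner (bop_apply ?R y) y)"
    using selfadjD[OF saR, of y y] cinner_commute[of y "bop_apply ?R y"] by simp
  then have "Im (cinner (bop_apply ?R y) y) = 0" by (metis cnj.simps(2) neg_equal_zero)
  then have y2: "Re (cinner (bop_apply ?R y) y) \<noteq> 0" using y1 complex_eqI by force
  have val: "Re (cinner (bop_apply (T - complex_of_real r *\<^sub>C e) z) z) = ?a z - r * (norm z)\<^sup>2"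
    if "bop_apply e z = z" for r z
    using that by (simp add: cinner_simps norm_sq)
  have y_nz: "y \<noteq> 0" using y1 by (auto simp: cinner_simps)
  define r1 where "r1 = ?a y / (norm y)\<^sup>2"
  have ax: "?a x = r0 * (norm x)\<^sup>2" and ay: "?a y = r1 * (norm y)\<^sup>2"
    using x y_nz by (simp_all add: r0_def r1_def)
  have "r1 \<noteq> r0" using y2 val[OF y, of r0] ay by auto
  define r where "r = (r0 + r1) / 2"
  have vx: "Re (cinner (bop_apply (T - complex_of_real r *\<^sub>C e) x) x) = (r0 - r1) / 2 * (norm x)\<^sup>2"
    unfolding val[OF x(1)] ax r_def by (simp add: field_simps)
  have vy: "Re (cinner (bop_apply (T - complex_of_real r *\<^sub>C e) y) y) = (r1 - r0) / 2 * (norm y)\<^sup>2"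
    unfolding val[OF y] ay r_def by (simp add: field_simps)
  show thesis
  proof (cases "r0 < r1")
    case True
    then show ?thesis using that[OF x(1) y, of r] x y_nz unfolding vx vy
      by (simp add: mult_neg_pos)
  next
    case False
    then have "r1 < r0" using \<open>r1 \<noteq> r0\<close> by simp
    then show ?thesis using that[OF y x(1), of r] x y_nz unfolding vx vy
      by (simp add: mult_neg_pos)
  qed
qed

text \<open>
  Let \<open>T1\<close> be a multiple of \<open>T - r e\<close> of norm at most \<open>1\<close> taking both signs, and \<open>S\<close> its absolute value.
  As \<open>T1\<close> and \<open>S\<close> commute, \<open>(T1 - S) (T1 + S) = T1\<^sup>2 - S\<^sup>2 = 0\<close>.  The first factor is non-zero because
  \<open>T1\<close> is negative on some vector while \<open>S\<close> is positive, and the second one for the same reason with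
  the signs exchanged.
\<close>

lemma zero_divisors:
  fixes T e :: "'h::complex_hilbert_space bop"
  assumes sa: "selfadj T" "selfadj e" and e: "e * e = e" "e * T = T" "T * e = T" "e \<noteq> 0"
    and nonscalar: "\<And>c. T \<noteq> c *\<^sub>C e"
  obtains U V where "U * V = 0" "U \<noteq> 0" "V \<noteq> 0" "e * U = U" "U * e = U" "e * V = V" "V * e = V"
    "\<And>W. W * T = T * W \<Longrightarrow> W * e = e * W \<Longrightarrow> W * U = U * W \<and> W * V = V * W"
proof -
  obtain r x y where xy: "bop_apply e x = x" "bop_apply e y = y"
    and neg: "Re (cinner (bop_apply (T - complex_of_real r *\<^sub>C e) x) x) < 0"
    and pos: "0 < Re (cinner (bop_apply (T - complex_of_real r *\<^sub>C e) y) y)"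
    using indefinite_shift[OF assms] by blast
  define T0 where "T0 = T - complex_of_real r *\<^sub>C e"
  obtain B where B: "\<And>x. norm (bop_apply T0 x) \<le> norm x * B" "B > 0"
    using bounded_linear.pos_bounded[OF bop_bounded_linear] by blast
  \<comment> \<open>the absolute value is available for contractions\<close>
  define T1 where "T1 = complex_of_real (1 / B) *\<^sub>C T0"
  have sa1: "selfadj T1" unfolding T1_def T0_def by (intro selfadj_closed sa)
  have "norm (bop_apply T1 x) \<le> norm x" for x
    using B(1)[of x] B(2) by (simp add: T1_def norm_scaleC norm_divide pos_divide_le_eq del: bop_apply_simps(4))
  then obtain S where S: "S * S = T1 * T1" "\<And>x. 0 \<le> Re (cinner (bop_apply S x) x)"
    "\<And>W. W * T1 = T1 * W \<Longrightarrow> W * S = S * W"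
    using absolute_value[OF sa1] by blast
  have T1_val: "Re (cinner (bop_apply T1 z) z) = Re (cinner (bop_apply T0 z) z) / B" for z
    by (simp add: T1_def cinner_simps del: of_real_divide)
  have comm1: "W * T1 = T1 * W" if "W * T = T * W" "W * e = e * W" for W
    using that by (simp add: T1_def T0_def algebra_simps bop_scale_mult)
  have commS: "W * S = S * W" if "W * T = T * W" "W * e = e * W" for W
    using S(3) comm1 that by blast
  have eT1: "e * T1 = T1 * e" by (rule comm1) (use e in simp_all)
  have eS: "e * S = S * e" by (rule commS) (use e in simp_all)
  have TS: "T1 * S = S * T1" using S(3) by simp
  define U V where "U = (T1 - S) * e" and "V = (T1 + S) * e"
  have eU: "e * (T1 - S) = (T1 - S) * e" and eV: "e * (T1 + S) = (T1 + S) * e"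
    using eT1 eS by (simp_all add: algebra_simps)
  show thesis
  proof (rule that[of U V])
    have "U * V = (T1 - S) * (e * (T1 + S)) * e" by (simp only: U_def V_def mult.assoc)
    also have "\<dots> = (T1 - S) * (T1 + S) * (e * e)" by (simp only: eV mult.assoc)
    also have "(T1 - S) * (T1 + S) = 0" using S(1) TS by (simp add: algebra_simps)
    finally show "U * V = 0" by simp
    have "e * U = (e * (T1 - S)) * e" "e * V = (e * (T1 + S)) * e"
      by (simp_all only: U_def V_def mult.assoc)
    then show "e * U = U" "e * V = V"
      unfolding eU eV by (simp_all only: mult.assoc e U_def V_def)
    show "U * e = U" "V * e = V" by (simp_all only: U_def V_def mult.assoc e)
    have "Re (cinner (bop_apply T1 x) x) < 0" "0 < Re (cinner (bop_apply T1 y) y)"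
      unfolding T1_val T0_def using neg pos B(2) by (simp_all only: divide_neg_pos divide_pos_pos)
    then have "Re (cinner (bop_apply U x) x) < 0" "Re (cinner (bop_apply V y) y) > 0"
      using S(2)[of x] S(2)[of y] xy by (simp_all add: U_def V_def cinner_simps)
    then show "U \<noteq> 0" "V \<noteq> 0" by (auto simp: cinner_simps)
    fix W assume W: "W * T = T * W" "W * e = e * W"
    have "W * (T1 - S) = (T1 - S) * W" "W * (T1 + S) = (T1 + S) * W"
      using comm1[OF W] commS[OF W] by (simp_all add: algebra_simps)
    then show "W * U = U * W \<and> W * V = V * W"
      unfolding U_def V_def by (metis W(2) mult.assoc)
  qed
qed

section \<open>Projections and primeness in factors\<close>

lemma commutant_closed:
  "1 \<in> commutant S" "T \<in> commutant S \<Longrightarrow> U \<in> commutant S \<Longrightarrow> T + U \<in> commutant S"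
  "T \<in> commutant S \<Longrightarrow> U \<in> commutant S \<Longrightarrow> T - U \<in> commutant S"
  "T \<in> commutant S \<Longrightarrow> U \<in> commutant S \<Longrightarrow> T * U \<in> commutant S"
  "T \<in> commutant S \<Longrightarrow> c *\<^sub>C T \<in> commutant S"
  unfolding commutant_def
  by (simp_all add: algebra_simps bop_scale_mult) (simp add: mult.assoc[symmetric])

lemma commutant_adj:
  assumes "\<And>T. T \<in> S \<Longrightarrow> adj T \<in> S" "T \<in> commutant S"
  shows "adj T \<in> commutant S"
  unfolding commutant_def
proof (intro CollectI ballI)
  fix X assume "X \<in> S"
  then have "T * adj X = adj X * T" using assms by (simp add: commutant_def)
  then have "adj (T * adj X) = adj (adj X * T)" by simp
  then show "adj T * X = X * adj T" by (simp add: adj_mult adj_adj)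
qed

lemma kernel_subspace: "complex_vector.subspace {x. bop_apply T x = 0}"
  by (simp add: complex_vector.subspace_def bop_linear)

lemma kernel_closed: "closed {x. bop_apply T x = 0}"
  by (rule closed_Collect_eq)
    (auto intro: bounded_linear.continuous_on[OF bop_bounded_linear])

locale vN_algebra =
  fixes A :: "'h::complex_hilbert_space bop set"
  assumes vN: "von_neumann_algebra A"
begin

lemma A_eq: "commutant (commutant A) = A" and A_adj: "T \<in> A \<Longrightarrow> adj T \<in> A"
  using vN by (auto simp: von_neumann_algebra_def)

lemmas A_closed = commutant_closed[where S = "commutant A", unfolded A_eq]

lemma in_A: "(\<And>W. W \<in> commutant A \<Longrightarrow> T * W = W * T) \<Longrightarrow> T \<in> A"
  using A_eq unfolding commutant_def by blast

lemma commutantD: "W \<in> commutant A \<Longrightarrow> T \<in> A \<Longrightarrow> W * T = T * W"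
  by (simp add: commutant_def)

text \<open>
  The projection commutes with the commutant, since the commutant is closed under adjoints.
\<close>

lemma proj_in_A:
  assumes sub: "complex_vector.subspace K" and P: "is_proj K P"
    and inv: "\<And>W x. W \<in> commutant A \<Longrightarrow> x \<in> K \<Longrightarrow> bop_apply W x \<in> K"
  shows "P \<in> A"
proof (rule in_A)
  fix W assume W: "W \<in> commutant A"
  have "adj W \<in> commutant A" by (rule commutant_adj[OF A_adj W])
  then show "P * W = W * P"
    using proj_commute[OF sub P inv[OF W] inv adj'] by blast
qed

text \<open>
  The vectors annihilated by all \<open>X a\<close> form a closed subspace \<open>K\<close> invariant under \<open>A\<close> and under its
  commutant.  Its projection is therefore a central element of \<open>A\<close>, that is, a scalar.  If \<open>X a Y = 0\<close>
  for all \<open>a\<close>, then \<open>K\<close> contains the range of \<open>Y\<close>; so for \<open>Y \<noteq> 0\<close> the scalar is \<open>1\<close> and \<open>X\<close>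
  vanishes everywhere.
\<close>

lemma prime:
  assumes center: "center A = range (\<lambda>c. c *\<^sub>C 1)" and X: "X \<in> A" and Y: "Y \<in> A"
    and XAY: "\<And>a. a \<in> A \<Longrightarrow> X * a * Y = 0"
  shows "X = 0 \<or> Y = 0"
proof (rule disjCI)
  assume Y0: "Y \<noteq> 0"
  define K where "K = (\<Inter>a\<in>A. {k. bop_apply (X * a) k = 0})"
  have K: "k \<in> K \<longleftrightarrow> (\<forall>a\<in>A. bop_apply (X * a) k = 0)" for k by (simp add: K_def)
  have sub: "complex_vector.subspace K"
    by (simp add: complex_vector.subspace_def K_def bop_linear)
  have cl: "closed K" unfolding K_def by (intro closed_INT ballI kernel_closed)
  obtain P where P: "is_proj K P" using projection_exists[OF sub cl] by blast
  have invA: "bop_apply T k \<in> K" if "T \<in> A" "k \<in> K" for T k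
    unfolding K
  proof
    fix a assume "a \<in> A"
    then have "bop_apply (X * (a * T)) k = 0" using that A_closed(4) K by blast
    then show "bop_apply (X * a) (bop_apply T k) = 0" by simp
  qed
  have "P \<in> A"
  proof (rule proj_in_A[OF sub P])
    fix W k assume W: "W \<in> commutant A" and k: "k \<in> K"
    show "bop_apply W k \<in> K" unfolding K
    proof
      fix a assume "a \<in> A"
      then have "W * (X * a) = X * a * W" using commutantD[OF W] A_closed(4)[OF X] by simp
      from arg_cong[OF this, of "\<lambda>B. bop_apply B k"]
      have "bop_apply (X * a) (bop_apply W k) = bop_apply W (bop_apply (X * a) k)" by simp
      then show "bop_apply (X * a) (bop_apply W k) = 0"
        using k \<open>a \<in> A\<close> unfolding K by (simp only: bop_linear) 
    qed
  qed
  moreover have "P * T = T * P" if "T \<in> A" for T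
    using proj_commute[OF sub P invA[OF that] invA[OF A_adj[OF that]] adj'] by blast
  ultimately have "P \<in> center A" by (simp add: center_def)
  then obtain c where c: "P = c *\<^sub>C 1" using center by auto
  obtain h where h: "bop_apply Y h \<noteq> 0" using Y0 bop_eqI[of Y 0] by auto
  have "bop_apply Y h \<in> K" unfolding K
    using XAY by (metis bop_apply_simps(1,6))
  then have "bop_apply P (bop_apply Y h) = bop_apply Y h" by (rule proj_fixes[OF sub P])
  then have "(c - 1) *\<^sub>C bop_apply Y h = 0"
    by (simp add: c complex_vector.scale_left_diff_distrib scaleC_one)
  then have "c = 1" using h by (simp add: complex_vector.scale_eq_0_iff)
  then have "x \<in> K" for x using proj_in[OF P, of x] by (simp add: c scaleC_one)
  then have "bop_apply (X * 1) x = 0" for x using A_closed(1) K by blast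
  then show "X = 0" by (intro bop_eqI) simp
qed

text \<open>
  \<open>T\<close> is a combination of its real and imaginary parts, so they cannot both be multiples of \<open>e\<close>.
\<close>

lemma selfadj_parts:
  assumes T: "T \<in> A" and "T * e = T" "e * T = T" "selfadj e" and nonscalar: "\<And>c. T \<noteq> c *\<^sub>C e"
  obtains S where "S \<in> A" "selfadj S" "e * S = S" "S * e = S" "\<And>c. S \<noteq> c *\<^sub>C e"
    "\<And>W. W * T = T * W \<Longrightarrow> W * adj T = adj T * W \<Longrightarrow> W * S = S * W"
proof -
  define R J where "R = T + adj T" and "J = \<i> *\<^sub>C (T - adj T)"
  have eT: "e * adj T = adj T" "adj T * e = adj T"
    using arg_cong[OF assms(2), of adj] arg_cong[OF assms(3), of adj] assms(4)
    by (simp_all add: adj_mult selfadj_def)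
  have A: "R \<in> A" "J \<in> A" unfolding R_def J_def using T A_adj A_closed by auto
  have sa: "selfadj R" "selfadj J" unfolding selfadj_def R_def J_def
    by (simp_all add: adj_add adj_scale adj_diff adj_adj add.commute complex_vector.scale_right_diff_distrib)
  have e: "e * R = R" "R * e = R" "e * J = J" "J * e = J"
    unfolding R_def J_def using eT assms by (simp_all add: algebra_simps bop_scale_mult)
  have comm: "W * R = R * W" "W * J = J * W" if "W * T = T * W" "W * adj T = adj T * W" for W
    unfolding R_def J_def using that by (simp_all add: algebra_simps bop_scale_mult)
  have "(\<forall>c. R \<noteq> c *\<^sub>C e) \<or> (\<forall>c. J \<noteq> c *\<^sub>C e)"
  proof (rule ccontr)
    assume "\<not> ?thesis"
    then obtain c d where cd: "R = c *\<^sub>C e" "J = d *\<^sub>C e" by blast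
    have "(R - \<i> *\<^sub>C J) = T + T"
      unfolding R_def J_def by (simp add: scaleC_scaleC complex_vector.scale_minus_left scaleC_one)
    then have "2 *\<^sub>C T = (c - \<i> * d) *\<^sub>C e"
      using scaleC_add_left[of 1 1 T]
      by (simp add: cd scaleC_scaleC scaleC_one complex_vector.scale_left_diff_distrib)
    then have "(1/2) *\<^sub>C 2 *\<^sub>C T = (1/2) *\<^sub>C (c - \<i> * d) *\<^sub>C e" by simp
    then have "T = (1/2 * (c - \<i> * d)) *\<^sub>C e" by (simp only: scaleC_scaleC) (simp add: scaleC_one)
    then show False using nonscalar by blast
  qed
  then show thesis
  proof
    assume "\<forall>c. R \<noteq> c *\<^sub>C e" then show thesis using that[OF A(1) sa(1) e(1,2) _ comm(1)] by blast
  next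
    assume "\<forall>c. J \<noteq> c *\<^sub>C e" then show thesis using that[OF A(2) sa(2) e(3,4) _ comm(2)] by blast
  qed
qed

text \<open>
  If \<open>T\<close> were not a multiple of \<open>e\<close>, there would be non-zero \<open>U\<close> and \<open>V\<close> in the centre of \<open>e A e\<close> with
  \<open>U V = 0\<close>.  Then \<open>U a V = U (e a e) V = (e a e) U V = 0\<close> for all \<open>a\<close>, against primeness.
\<close>

lemma corner_center:
  assumes center: "center A = range (\<lambda>c. c *\<^sub>C 1)"
    and e: "e \<in> A" "selfadj e" "e * e = e"
    and T: "T \<in> A" "e * T = T" "T * e = T"
    and comm: "\<And>a. a \<in> A \<Longrightarrow> e * a = a \<Longrightarrow> a * e = a \<Longrightarrow> T * a = a * T"
  shows "\<exists>z\<in>center A. T = z * e"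
proof (rule ccontr)
  assume contr: "\<not> ?thesis"
  have ns: "T \<noteq> c *\<^sub>C e" for c
  proof
    assume "T = c *\<^sub>C e"
    then have "T = (c *\<^sub>C 1) * e" by (simp add: bop_scale_mult)
    then show False using contr center by blast
  qed
  have e0: "e \<noteq> 0" using ns[of 0] T(2) by auto
  obtain S where S: "S \<in> A" "selfadj S" "e * S = S" "S * e = S" "\<And>c. S \<noteq> c *\<^sub>C e"
    "\<And>W. W * T = T * W \<Longrightarrow> W * adj T = adj T * W \<Longrightarrow> W * S = S * W"
    using selfadj_parts[OF T(1,3,2) e(2) ns] by blast
  obtain U V where UV: "U * V = 0" "U \<noteq> 0" "V \<noteq> 0" "e * U = U" "U * e = U" "e * V = V" "V * e = V"
    "\<And>W. W * S = S * W \<Longrightarrow> W * e = e * W \<Longrightarrow> W * U = U * W \<and> W * V = V * W"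
    using zero_divisors[OF S(2) e(2,3) S(3,4) e0 S(5)] by blast
  have A: "U \<in> A" "V \<in> A"
    by (rule in_A, use UV(8) commutantD S(1) e(1) in force)+
  have "U * a * V = 0" if a: "a \<in> A" for a
  proof -
    define b where "b = e * a * e"
    have b: "b \<in> A" "e * b = b" "b * e = b"
      unfolding b_def using a e A_closed by (simp_all add: mult.assoc) (simp_all add: mult.assoc[symmetric] e)
    have ab: "adj b \<in> A" "e * adj b = adj b" "adj b * e = adj b"
      using A_adj[OF b(1)] arg_cong[OF b(2), of adj] arg_cong[OF b(3), of adj] e(2)
      by (simp_all add: adj_mult selfadj_def)
    have "adj (T * adj b) = adj (adj b * T)" using comm[OF ab] by simp
    then have "b * adj T = adj T * b" by (simp add: adj_mult adj_adj)
    then have "b * S = S * b" using S(6) comm[OF b] by simp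
    then have bU: "b * U = U * b" using UV(8)[of b] b by simp
    have "U * a * V = (U * e) * a * (e * V)" using UV by simp
    also have "\<dots> = (U * b) * V" by (simp only: b_def mult.assoc)
    also have "\<dots> = b * (U * V)" unfolding bU[symmetric] by (simp only: mult.assoc)
    finally show ?thesis using UV by simp
  qed
  then show False using prime[OF center A] UV by blast
qed

text \<open>
  The kernel of the zero divisor \<open>U\<close> is a proper subspace because \<open>U \<noteq> 0\<close>, and it is non-zero because
  it contains the range of \<open>V\<close>.
\<close>

lemma nontrivial_projection:
  assumes T: "T \<in> A" "\<And>c. T \<noteq> c *\<^sub>C 1"
  obtains P where "P \<in> A" "selfadj P" "P * P = P" "P \<noteq> 0" "P \<noteq> 1"
proof -
  obtain S where S: "S \<in> A" "selfadj S" "\<And>c. S \<noteq> c *\<^sub>C 1"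
    by (rule selfadj_parts[OF T(1) _ _ selfadj_closed(4) T(2)]) (simp, simp, blast)
  have "(1::'h bop) \<noteq> 0"
  proof
    assume "(1::'h bop) = 0"
    then have "S = 0 *\<^sub>C 1" by (metis mult_1 mult_zero_left complex_vector.scale_zero_left)
    then show False using S(3) by blast
  qed
  then obtain U V where UV: "U * V = 0" "U \<noteq> 0" "V \<noteq> 0"
    "\<And>W. W * S = S * W \<Longrightarrow> W * 1 = 1 * W \<Longrightarrow> W * U = U * W \<and> W * V = V * W"
    using zero_divisors[OF S(2) selfadj_closed(4) mult_1_left mult_1_left mult_1_right _ S(3)] by blast
  define K where "K = {x. bop_apply U x = 0}"
  have sub: "complex_vector.subspace K" unfolding K_def by (rule kernel_subspace)
  obtain P where P: "is_proj K P"
    using projection_exists[OF sub] kernel_closed K_def by blast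
  show thesis
  proof (rule that)
    show "P \<in> A"
    proof (rule proj_in_A[OF sub P])
      fix W x assume W: "W \<in> commutant A" and x: "x \<in> K"
      have "W * U = U * W" using UV(4) commutantD[OF W S(1)] by simp
      from arg_cong[OF this, of "\<lambda>B. bop_apply B x"] x
      show "bop_apply W x \<in> K" by (simp add: K_def bop_linear)
    qed
    show "selfadj P" by (rule selfadjI) (rule proj_selfadj[OF sub P])
    show "P * P = P" by (rule proj_idem[OF sub P])
    obtain v where v: "bop_apply V v \<noteq> 0" using UV(3) bop_eqI[of V 0] by auto
    have "bop_apply V v \<in> K"
      using arg_cong[OF UV(1), of "\<lambda>B. bop_apply B v"] by (simp add: K_def)
    then show "P \<noteq> 0" using proj_fixes[OF sub P] v by fastforce
    show "P \<noteq> 1"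
    proof
      assume "P = 1"
      then have "x \<in> K" for x using proj_in[OF P, of x] by simp
      then have "U = 0" by (intro bop_eqI) (simp add: K_def)
      then show False using UV(2) by simp
    qed
  qed
qed

lemma factor_peirce:
  assumes center: "center A = range (\<lambda>c. c *\<^sub>C 1)"
    and P: "P \<in> A" "selfadj P" "P * P = P" "P \<noteq> 0" "P \<noteq> 1"
  shows "peirce A P (1 - P)"
proof
  have Q: "1 - P \<in> A" "selfadj (1 - P)" "(1 - P) * (1 - P) = 1 - P"
    using P A_closed selfadj_closed by (auto simp: algebra_simps)
  show "1 - P \<in> A" "(1 - P) * (1 - P) = 1 - P" by (fact Q)+
  show "x = 0 \<or> y = 0" if "x \<in> A" "y \<in> A" "\<And>a. a \<in> A \<Longrightarrow> x * a * y = 0" for x y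
    using prime[OF center that] by blast
  show "\<exists>z\<in>center A. x = z * P"
    if "x \<in> A" "P * x = x" "x * P = x" "\<And>a. a \<in> A \<Longrightarrow> P * a = a \<Longrightarrow> a * P = a \<Longrightarrow> x * a = a * x" for x
    by (rule corner_center[OF center P(1-3) that])
  show "\<exists>z\<in>center A. x = z * (1 - P)"
    if "x \<in> A" "(1 - P) * x = x" "x * (1 - P) = x"
      "\<And>a. a \<in> A \<Longrightarrow> (1 - P) * a = a \<Longrightarrow> a * (1 - P) = a \<Longrightarrow> x * a = a * x" for x
    by (rule corner_center[OF center Q that])
qed (use P A_closed in \<open>auto simp: bop_scale_mult algebra_simps\<close>)

end

lemma nonscalar_exists:
  assumes "cdim_ge A 2"
  obtains T where "T \<in> A" "\<And>c. T \<noteq> c *\<^sub>C (1::'h::complex_hilbert_space bop)"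
proof -
  obtain B where B: "B \<subseteq> A" "card B = 2" "complex_vector.independent B"
    using assms unfolding cdim_ge_def by blast
  obtain x y where xy: "B = {x, y}" "x \<noteq> y" using B(2) by (auto simp: card_2_iff)
  have "\<not> (\<forall>T\<in>B. \<exists>c. T = c *\<^sub>C (1::'h bop))"
  proof
    assume "\<forall>T\<in>B. \<exists>c. T = c *\<^sub>C (1::'h bop)"
    then obtain c d where cd: "x = c *\<^sub>C 1" "y = d *\<^sub>C (1::'h bop)" using xy by auto
    have nz: "x \<noteq> 0" "y \<noteq> 0" using B(3) complex_vector.dependent_zero xy by auto
    then have "d \<noteq> 0" using cd by auto
    then have "x = (c / d) *\<^sub>C y" by (simp add: cd scaleC_scaleC)
    then have "x \<in> complex_vector.span {y}"
      using complex_vector.span_base complex_vector.span_scale by (metis singletonI)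
    then show False using B(3) xy unfolding complex_vector.dependent_def by force
  qed
  then show thesis using that B(1) by blast
qed

theorem corollary3p13:
  fixes A :: "'h::complex_hilbert_space bop set" and n :: nat and \<phi> :: "'h bop \<Rightarrow> 'h bop"
  assumes "factor A" and "cdim_ge A 2" and "n \<ge> 2"
    and "lie_n_derivation n A \<phi>"
  shows "standard n A \<phi>"
proof -
  have center: "center A = range (\<lambda>c. c *\<^sub>C 1)" and "von_neumann_algebra A"
    using assms(1) by (auto simp: factor_def)
  then interpret vN_algebra A by unfold_locales
  obtain T where "T \<in> A" "\<And>c. T \<noteq> c *\<^sub>C 1" using nonscalar_exists[OF assms(2)] by blast
  then obtain P where "P \<in> A" "selfadj P" "P * P = P" "P \<noteq> 0" "P \<noteq> 1"
    by (rule nontrivial_projection)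
  then interpret peirce A P "1 - P" by (rule factor_peirce[OF center])
  interpret lie_n A P "1 - P" n \<phi> using assms(3,4) by unfold_locales
  show ?thesis by (rule lie_n_standard)
qed

end
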